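(* Let $l>0$, let $\gamma\colon[0,l]\to\mathbb{R}^3$ be a $C^3$ unit-speed curve with curvature $\kappa>0$ everywhere and torsion $\tau$, and let $E$ be the functional on $W^{1,4}([0,l])$ with values in $[0,+\infty]$ given by $$E(\theta)=\int_0^l \frac{\left(\kappa^2\cos^2\theta+(\theta'+\tau)^2\right)^2}{\kappa^2\cos^2\theta}\,dt .$$ Then: (1) There is a minimizer of $E$ on $W^{1,4}([0,l])$, i.e., there is $\theta_{\min}\in W^{1,4}([0,l])$ such that $E(\theta_{\min})\le E(\theta)$ for all $\theta\in W^{1,4}([0,l])$. (2) For any $a,b\in\mathbb{R}$, there is a minimizer of $E$ on the subset $\{\theta\in W^{1,4}([0,l]) \mid \theta(0)=a \text{ and } \theta(l)=b\}$ of $W^{1,4}([0,l])$.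
   Context: The integrand of $E$ is understood to be $0$ at any point $t$ where both the numerator and the denominator vanish, and $+\infty$ at any point where the denominator vanishes but the numerator does not. Here $\kappa\in C^1([0,l],\mathbb{R}_{>0})$ and $\tau\in C^0([0,l])$ are the curvature and torsion of $\gamma$. $W^{1,4}([0,l])$ is the real-valued Sobolev space of functions on $(0,l)$ with weak derivative in $L^4$; each element is identified with its continuous representative, extended continuously to $[0,l]$, so that pointwise values such as $\theta(0)$, $\theta(l)$ make sense. *)

theory Defs
  imports "HOL-Analysis.Analysis"
begin

(* Derivatives on a closed interval are one-sided at the endpoints. *)
primrec Ck_on :: "nat \<Rightarrow> real set \<Rightarrow> (real \<Rightarrow> 'a::real_normed_vector) \<Rightarrow> bool" where
  "Ck_on 0 S f \<longleftrightarrow> continuous_on S f"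
| "Ck_on (Suc k) S f \<longleftrightarrow>
     (\<exists>f'. (\<forall>t\<in>S. (f has_vector_derivative f' t) (at t within S)) \<and> Ck_on k S f')"

definition deriv_within :: "real \<Rightarrow> (real \<Rightarrow> 'a::real_normed_vector) \<Rightarrow> real \<Rightarrow> 'a" where
  "deriv_within l f t = vector_derivative f (at t within {0..l})"

definition tangent :: "real \<Rightarrow> (real \<Rightarrow> real^3) \<Rightarrow> real \<Rightarrow> real^3" where
  "tangent l \<gamma> = deriv_within l \<gamma>"

(* Curvature, normal, binormal and torsion in the form valid for unit-speed curves;
   normal, binormal and torsion are meaningful only where the curvature is nonzero. *)
definition curvature :: "real \<Rightarrow> (real \<Rightarrow> real^3) \<Rightarrow> real \<Rightarrow> real" where
  "curvature l \<gamma> t = norm (deriv_within l (tangent l \<gamma>) t)"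

definition principal_normal :: "real \<Rightarrow> (real \<Rightarrow> real^3) \<Rightarrow> real \<Rightarrow> real^3" where
  "principal_normal l \<gamma> t = deriv_within l (tangent l \<gamma>) t /\<^sub>R curvature l \<gamma> t"

definition binormal :: "real \<Rightarrow> (real \<Rightarrow> real^3) \<Rightarrow> real \<Rightarrow> real^3" where
  "binormal l \<gamma> t = cross3 (tangent l \<gamma> t) (principal_normal l \<gamma> t)"

(* Sign convention: N' = - \<kappa> T + \<tau> B. *)
definition torsion :: "real \<Rightarrow> (real \<Rightarrow> real^3) \<Rightarrow> real \<Rightarrow> real" where
  "torsion l \<gamma> t = deriv_within l (principal_normal l \<gamma>) t \<bullet> binormal l \<gamma> t"

definition test_function :: "real \<Rightarrow> (real \<Rightarrow> real) \<Rightarrow> bool" where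
  "test_function l \<phi> \<longleftrightarrow>
     (\<forall>k. Ck_on k UNIV \<phi>) \<and>
     compact (closure {t. \<phi> t \<noteq> 0}) \<and> closure {t. \<phi> t \<noteq> 0} \<subseteq> {0<..<l}"

definition locally_integrable :: "real \<Rightarrow> (real \<Rightarrow> real) \<Rightarrow> bool" where
  "locally_integrable l u \<longleftrightarrow>
     (\<forall>K. compact K \<and> K \<subseteq> {0<..<l} \<longrightarrow> integrable (lebesgue_on K) u)"

definition has_weak_deriv :: "real \<Rightarrow> (real \<Rightarrow> real) \<Rightarrow> (real \<Rightarrow> real) \<Rightarrow> bool" where
  "has_weak_deriv l u g \<longleftrightarrow>
     locally_integrable l u \<and> locally_integrable l g \<and>
     (\<forall>\<phi>. test_function l \<phi> \<longrightarrow>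
        (LINT t|lebesgue_on {0<..<l}. u t * deriv \<phi> t) =
        - (LINT t|lebesgue_on {0<..<l}. g t * \<phi> t))"

(* An arbitrary representative; weak derivatives are unique only up to null sets. *)
definition weak_deriv :: "real \<Rightarrow> (real \<Rightarrow> real) \<Rightarrow> real \<Rightarrow> real" where
  "weak_deriv l u = (SOME g. has_weak_deriv l u g)"

definition L4 :: "real \<Rightarrow> (real \<Rightarrow> real) set" where
  "L4 l = {f. f \<in> borel_measurable (lebesgue_on {0<..<l}) \<and>
              integrable (lebesgue_on {0<..<l}) (\<lambda>t. \<bar>f t\<bar> ^ 4)}"

(* W^{1,4}(0,l). An element is represented by a function whose restriction to [0,l] is the
   continuous representative; its values outside [0,l] are irrelevant. *)
definition W14 :: "real \<Rightarrow> (real \<Rightarrow> real) set" where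
  "W14 l = {\<theta>. continuous_on {0..l} \<theta> \<and> \<theta> \<in> L4 l \<and> (\<exists>g\<in>L4 l. has_weak_deriv l \<theta> g)}"

definition quot :: "real \<Rightarrow> real \<Rightarrow> ennreal" where
  "quot num den =
     (if den = 0 then (if num = 0 then 0 else \<infinity>) else ennreal (num / den))"

definition energy :: "real \<Rightarrow> (real \<Rightarrow> real^3) \<Rightarrow> (real \<Rightarrow> real) \<Rightarrow> ennreal" where
  "energy l \<gamma> \<theta> =
     (\<integral>\<^sup>+ t. quot
        (((curvature l \<gamma> t)\<^sup>2 * (cos (\<theta> t))\<^sup>2 + (weak_deriv l \<theta> t + torsion l \<gamma> t)\<^sup>2)\<^sup>2)
        ((curvature l \<gamma> t)\<^sup>2 * (cos (\<theta> t))\<^sup>2)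
      \<partial>lebesgue_on {0<..<l})"

end

theory Submission
  imports Defs "HOL-Complex_Analysis.Great_Picard"
begin

text \<open>
  The proof is the direct method of the calculus of variations; compactness of the derivatives takes
  the form of almost everywhere convergence of convex combinations.

  Write \<open>a = \<kappa>\<^sup>2 cos\<^sup>2 \<theta>\<close> and \<open>q = \<theta>' + \<tau>\<close>. The integrand \<open>(a + q\<^sup>2)\<^sup>2 / a\<close>, with the stated
  conventions at \<open>a = 0\<close>, is the supremum over \<open>s \<ge> 0\<close> and \<open>r\<close> of the functions
  \<open>2 s (a + 2 r q - r\<^sup>2) - s\<^sup>2 a\<close>, which are affine in the pair \<open>(a, q)\<close>. It is therefore jointly convex
  (\<open>quot_convex\<close>) and lower semicontinuous (\<open>quot_lsc\<close>), including at \<open>a = 0\<close>. It also dominates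
  \<open>q\<^sup>2\<close>, and \<open>q\<^sup>4\<close> up to a factor \<open>max \<kappa>\<^sup>2\<close>; so bounded energy bounds \<open>\<theta>'\<close> in \<open>L\<^sup>2\<close>, and finite energy
  puts \<open>\<theta>'\<close> into \<open>L\<^sup>4\<close>.

  Let \<open>\<theta>\<^sub>n\<close> be a minimizing sequence with \<open>\<theta>\<^sub>n(0)\<close> bounded. The bound on \<open>\<theta>\<^sub>n'\<close> in \<open>L\<^sup>2\<close> makes the
  sequence equicontinuous, so by Arzela-Ascoli a subsequence converges uniformly to some \<open>\<theta>\<close>.
  Convex combinations of tails of the derivatives converge almost everywhere to some \<open>h\<close>
  (\<open>Mazur_AE\<close>, a consequence of the parallelogram law). The same combinations of the \<open>\<theta>\<^sub>n\<close> still
  converge to \<open>\<theta>\<close>, hence \<open>h\<close> is the weak derivative of \<open>\<theta>\<close>; and the same combinations of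
  \<open>\<kappa>\<^sup>2 cos\<^sup>2 \<theta>\<^sub>n\<close> converge to \<open>\<kappa>\<^sup>2 cos\<^sup>2 \<theta>\<close>. Applying lower semicontinuity, Fatou's lemma and joint
  convexity to these combinations bounds the energy of \<open>\<theta>\<close> by the infimum
  (\<open>energy_sequentially_compact\<close>). Joint convexity in \<open>(a, q)\<close> is what makes this work even though
  \<open>cos\<^sup>2 \<theta>\<close> is not convex in \<open>\<theta>\<close>.

  The value \<open>\<theta>(0)\<close> is prescribed in the boundary value problem; in the free problem it can be moved
  into \<open>[0, \<pi>]\<close> because \<open>cos\<^sup>2\<close> has period \<open>\<pi>\<close>. If the infimum is infinite, every admissible function
  is a minimizer, and there is one, since affine functions are admissible.

  Two facts connect the definition of weak derivatives by test functions with this argument: the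
  fundamental theorem \<open>weak_deriv_FTC\<close>, which yields equicontinuity, and the uniqueness
  \<open>weak_deriv_unique\<close>, by which the energy may be computed with any weak derivative. Both need
  smooth functions of compact support, which are built from \<open>exp (- 1 / x)\<close>.
\<close>

section \<open>Smooth functions of compact support\<close>

lemma Ck_on_SucD: "Ck_on (Suc k) S f \<Longrightarrow> Ck_on k S f"
proof (induction k arbitrary: f)
  case 0
  then show ?case
    by (auto simp: continuous_on_eq_continuous_within intro: has_vector_derivative_continuous)
next
  case (Suc k)
  then show ?case by auto
qed

lemma Ck_on_UNIV_SucI:
  fixes f :: "real \<Rightarrow> real"
  assumes "\<And>t. (f has_real_derivative f' t) (at t)" "Ck_on k UNIV f'"
  shows "Ck_on (Suc k) UNIV f"
  using assms unfolding Ck_on.simps has_real_derivative_iff_has_vector_derivative by blast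

lemma Ck_on_mult:
  fixes f g :: "real \<Rightarrow> real"
  shows "Ck_on k S f \<Longrightarrow> Ck_on k S g \<Longrightarrow> Ck_on k S (\<lambda>t. f t * g t)"
  and Ck_on_add:
  "Ck_on k S f \<Longrightarrow> Ck_on k S g \<Longrightarrow> Ck_on k S (\<lambda>t. f t + g t)"
proof -
  have add: "Ck_on k S f \<Longrightarrow> Ck_on k S g \<Longrightarrow> Ck_on k S (\<lambda>t. f t + g t)"
    for k and f g :: "real \<Rightarrow> real"
  proof (induction k arbitrary: f g)
    case 0
    then show ?case by (auto intro: continuous_intros)
  next
    case (Suc k)
    from Suc.prems obtain f' g' where
      "\<forall>t\<in>S. (f has_vector_derivative f' t) (at t within S)" "Ck_on k S f'"
      "\<forall>t\<in>S. (g has_vector_derivative g' t) (at t within S)" "Ck_on k S g'" by auto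
    with Suc.IH[of f' g'] show ?case
      by (auto intro!: exI[of _ "\<lambda>t. f' t + g' t"] has_vector_derivative_add)
  qed
  then show "Ck_on k S f \<Longrightarrow> Ck_on k S g \<Longrightarrow> Ck_on k S (\<lambda>t. f t + g t)" .
  show "Ck_on k S f \<Longrightarrow> Ck_on k S g \<Longrightarrow> Ck_on k S (\<lambda>t. f t * g t)"
  proof (induction k arbitrary: f g)
    case 0
    then show ?case by (auto intro: continuous_intros)
  next
    case (Suc k)
    from Suc.prems obtain f' g' where
      d: "\<forall>t\<in>S. (f has_vector_derivative f' t) (at t within S)" "Ck_on k S f'"
      "\<forall>t\<in>S. (g has_vector_derivative g' t) (at t within S)" "Ck_on k S g'" by auto
    have "Ck_on k S (\<lambda>t. f t * g' t + f' t * g t)"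
      using d Ck_on_SucD[OF Suc.prems(1)] Ck_on_SucD[OF Suc.prems(2)] by (intro add Suc.IH)
    moreover have "\<forall>t\<in>S. ((\<lambda>t. f t * g t) has_vector_derivative f t * g' t + f' t * g t) (at t within S)"
      using d by (auto intro!: has_vector_derivative_mult)
    ultimately show ?case by auto
  qed
qed

lemma Ck_on_const: "Ck_on k S (\<lambda>t. c)"
proof (induction k arbitrary: c)
  case (Suc k)
  then show ?case by (auto intro!: exI[of _ "\<lambda>t. 0"] has_vector_derivative_const)
qed auto

lemma Ck_on_affine:
  fixes f :: "real \<Rightarrow> real"
  shows "Ck_on k UNIV f \<Longrightarrow> Ck_on k UNIV (\<lambda>t. f (c * t + d))"
proof (induction k arbitrary: f)
  case 0
  then show ?case by (auto intro!: continuous_intros elim: continuous_on_compose2)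
next
  case (Suc k)
  from Suc.prems obtain f' where f': "\<And>t. (f has_vector_derivative f' t) (at t)" "Ck_on k UNIV f'"
    by auto
  have "((\<lambda>t. f (c * t + d)) has_real_derivative c * f' (c * t + d)) (at t)" for t
  proof -
    have "((\<lambda>t. c * t + d) has_real_derivative c) (at t)" by (auto intro!: derivative_eq_intros)
    from DERIV_chain2[OF _ this, of f "f' (c * t + d)"] show ?thesis using f'(1)[of "c * t + d"]
      by (simp add: has_real_derivative_iff_has_vector_derivative mult.commute)
  qed
  moreover have "Ck_on k UNIV (\<lambda>t. c * f' (c * t + d))"
    using Ck_on_mult[OF Ck_on_const[of k UNIV c] Suc.IH[OF f'(2)]] by simp
  ultimately show ?case by (rule Ck_on_UNIV_SucI)
qed

lemma poly_times_exp_neg_tendsto_0: "((\<lambda>y::real. poly p y * exp (- y)) \<longlongrightarrow> 0) at_top"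
proof -
  have "((\<lambda>y::real. \<Sum>i\<le>degree p. coeff p i * (y ^ i / exp y)) \<longlongrightarrow> (\<Sum>i\<le>degree p. coeff p i * 0)) at_top"
    by (intro tendsto_intros tendsto_power_div_exp_0)
  then show ?thesis
    by (simp add: poly_altdef exp_minus divide_inverse sum_distrib_right mult.assoc)
qed

text \<open>
  The functions \<open>p(1/t) exp (- 1/t)\<close>, extended by zero to \<open>t \<le> 0\<close>, for all polynomials \<open>p\<close> at once:
  this family is closed under differentiation, so smoothness is an induction over the order.
\<close>
definition flat_exp :: "real poly \<Rightarrow> real \<Rightarrow> real" where
  "flat_exp p t = (if t \<le> 0 then 0 else poly p (1/t) * exp (- (1/t)))"

lemma flat_exp_deriv:
  "(flat_exp p has_real_derivative flat_exp ([:0,0,1:] * (p - pderiv p)) t) (at t)"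
proof -
  consider "t < 0" | "t = 0" | "t > 0" by linarith
  then show ?thesis
  proof cases
    case 1
    have "((\<lambda>_. 0) has_real_derivative 0) (at t)" by simp
    then have "(flat_exp p has_real_derivative 0) (at t)"
      by (rule has_field_derivative_transform_within_open[of _ _ _ "{..<0}"])
         (use 1 in \<open>auto simp: flat_exp_def\<close>)
    then show ?thesis using 1 by (simp add: flat_exp_def)
  next
    case 3
    have "((\<lambda>t. poly p (1/t) * exp (- (1/t))) has_real_derivative
        flat_exp ([:0,0,1:] * (p - pderiv p)) t) (at t)"
      using 3 by (auto intro!: derivative_eq_intros DERIV_chain2[of "poly p"] poly_DERIV
         simp: flat_exp_def field_simps power2_eq_square)
    then show ?thesis
      by (rule has_field_derivative_transform_within_open[of _ _ _ "{0<..}"])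
         (use 3 in \<open>auto simp: flat_exp_def\<close>)
  next
    case 2
    have "((\<lambda>h. poly ([:0,1:]*p) (inverse h) * exp (- inverse h)) \<longlongrightarrow> 0) (at_right 0)"
      using filterlim_compose[OF poly_times_exp_neg_tendsto_0 filterlim_inverse_at_top_right] .
    then have R: "((\<lambda>h. flat_exp p h / h) \<longlongrightarrow> 0) (at_right 0)"
      by (rule Lim_transform_eventually)
         (auto simp: eventually_at_right_field flat_exp_def field_simps intro!: exI[of _ 1])
    have L: "((\<lambda>h. flat_exp p h / h) \<longlongrightarrow> 0) (at_left 0)"
      by (rule Lim_transform_eventually[OF tendsto_const])
         (auto simp: eventually_at_left_field flat_exp_def intro!: exI[of _ "-1"])
    have "((\<lambda>h. flat_exp p h / h) \<longlongrightarrow> 0) (at 0)"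
      using L R by (simp add: filterlim_at_split)
    then show ?thesis using 2
      by (simp add: DERIV_def) (simp add: flat_exp_def)
  qed
qed

lemma Ck_on_flat_exp: "Ck_on k UNIV (flat_exp p)"
proof (induction k arbitrary: p)
  case 0
  then show ?case
    using flat_exp_deriv by (auto simp: continuous_on_eq_continuous_within intro: DERIV_isCont)
next
  case (Suc k)
  then show ?case using flat_exp_deriv by (intro Ck_on_UNIV_SucI)
qed

text \<open>
  The derivative \<open>\<eta>\<close> is the bump \<open>exp (- 1/t) exp (- 1/(1 - t))\<close> on the unit interval, normalized, and
  \<open>\<psi>\<close> is its antiderivative, which is constant wherever the bump vanishes.
\<close>
lemma smooth_step_exists:
  obtains \<psi> \<eta> :: "real \<Rightarrow> real" where
    "\<And>t. (\<psi> has_real_derivative \<eta> t) (at t)" "\<And>k. Ck_on k UNIV \<eta>"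
    "\<And>t. 0 \<le> \<eta> t" "\<And>t. t \<le> 0 \<Longrightarrow> \<psi> t = 0" "\<And>t. 1 \<le> t \<Longrightarrow> \<psi> t = 1"
    "\<And>t. t \<le> 0 \<or> 1 \<le> t \<Longrightarrow> \<eta> t = 0"
proof -
  define \<beta> where "\<beta> t = flat_exp 1 t * flat_exp 1 (1 - t)" for t
  have \<beta>: "Ck_on k UNIV \<beta>" for k
    using Ck_on_mult[OF Ck_on_flat_exp[of k 1] Ck_on_affine[OF Ck_on_flat_exp[of k 1], of "-1" 1]]
    by (simp add: \<beta>_def[abs_def])
  have \<beta>0: "\<beta> t \<ge> 0" for t by (simp add: \<beta>_def flat_exp_def)
  have \<beta>pos: "\<beta> t > 0" if "0 < t" "t < 1" for t using that by (simp add: \<beta>_def flat_exp_def)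
  have \<beta>z: "\<beta> t = 0" if "t \<le> 0 \<or> 1 \<le> t" for t using that by (auto simp: \<beta>_def flat_exp_def)
  have "\<exists>F. \<forall>x. -\<infinity> < ereal x \<longrightarrow> ereal x < \<infinity> \<longrightarrow> (F has_vector_derivative \<beta> x) (at x)"
    using \<beta>[of 0] by (intro einterval_antiderivative) (auto simp: continuous_on_eq_continuous_at)
  then obtain F where F: "\<And>x. (F has_real_derivative \<beta> x) (at x)"
    by (auto simp: has_real_derivative_iff_has_vector_derivative)
  have le: "F t = F 0" if "t \<le> 0" for t
  proof (cases "t = 0")
    case False
    have "\<exists>z>t. z < 0 \<and> F 0 - F t = (0 - t) * \<beta> z"
      using False that F by (intro MVT2) auto
    then show ?thesis using \<beta>z by auto
  qed simp
  have ge: "F t = F 1" if "t \<ge> 1" for t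
  proof (cases "t = 1")
    case False
    have "\<exists>z>1. z < t \<and> F t - F 1 = (t - 1) * \<beta> z"
      using False that F by (intro MVT2) auto
    then show ?thesis using \<beta>z by auto
  qed simp
  have "\<exists>z>0. z < 1 \<and> F 1 - F 0 = (1 - 0) * \<beta> z"
    using F by (intro MVT2) auto
  then obtain z where "0 < z" "z < 1" "F 1 - F 0 = \<beta> z" by auto
  then have pos: "F 1 - F 0 > 0" using \<beta>pos[of z] by simp
  show ?thesis
  proof (rule that[of "\<lambda>t. (F t - F 0) / (F 1 - F 0)" "\<lambda>t. \<beta> t / (F 1 - F 0)"])
    show "((\<lambda>t. (F t - F 0) / (F 1 - F 0)) has_real_derivative \<beta> t / (F 1 - F 0)) (at t)" for t
      using F pos by (auto intro!: derivative_eq_intros)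
    show "Ck_on k UNIV (\<lambda>t. \<beta> t / (F 1 - F 0))" for k
      using Ck_on_mult[OF \<beta> Ck_on_const[of k UNIV "1 / (F 1 - F 0)"]] by simp
    show "0 \<le> \<beta> t / (F 1 - F 0)" for t using pos \<beta>0[of t] by simp
    show "(F t - F 0) / (F 1 - F 0) = 0" if "t \<le> 0" for t using le[OF that] by simp
    show "(F t - F 0) / (F 1 - F 0) = 1" if "1 \<le> t" for t using ge[OF that] pos by simp
    show "\<beta> t / (F 1 - F 0) = 0" if "t \<le> 0 \<or> 1 \<le> t" for t using \<beta>z[OF that] by simp
  qed
qed


lemma test_function_C1:
  assumes "test_function l \<phi>"
  shows "(\<phi> has_real_derivative deriv \<phi> t) (at t)" "continuous_on UNIV \<phi>" "continuous_on UNIV (deriv \<phi>)"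
proof -
  have "Ck_on (Suc 0) UNIV \<phi>" using assms unfolding test_function_def by blast
  then obtain \<phi>' where \<phi>': "\<And>t. (\<phi> has_real_derivative \<phi>' t) (at t)" "continuous_on UNIV \<phi>'"
    by (auto simp: has_real_derivative_iff_has_vector_derivative)
  then have "deriv \<phi> = \<phi>'" by (auto intro!: DERIV_imp_deriv)
  with \<phi>' show "(\<phi> has_real_derivative deriv \<phi> t) (at t)" "continuous_on UNIV (deriv \<phi>)" by auto
  show "continuous_on UNIV \<phi>" using \<phi>'(1) by (auto simp: continuous_on_eq_continuous_at intro: DERIV_isCont)
qed

text \<open>
  The support is replaced by an interval on which local integrability can be applied. Two extra points
  are added to it so that the interval is nondegenerate even if the function vanishes.
\<close>
lemma test_function_support:
  assumes "test_function l \<phi>" "l > 0"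
  obtains a b where "0 < a" "a < b" "b < l" "\<And>t. t \<notin> {a..b} \<Longrightarrow> \<phi> t = 0" "\<And>t. t \<notin> {a..b} \<Longrightarrow> deriv \<phi> t = 0"
proof -
  define K where "K = closure {t. \<phi> t \<noteq> 0}"
  have K: "compact K" "K \<subseteq> {0<..<l}" "\<And>t. t \<notin> K \<Longrightarrow> \<phi> t = 0"
    using assms closure_subset[of "{t. \<phi> t \<noteq> 0}"] by (auto simp: test_function_def K_def)
  define L where "L = insert (l/3) (insert (2*l/3) K)"
  have L: "compact L" "L \<noteq> {}" "L \<subseteq> {0<..<l}" "K \<subseteq> L" "l/3 \<in> L" "2*l/3 \<in> L"
    using K assms by (auto simp: L_def)
  obtain a where a: "a \<in> L" "\<And>t. t \<in> L \<Longrightarrow> a \<le> t" using compact_attains_inf[OF L(1,2)] by blast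
  obtain b where b: "b \<in> L" "\<And>t. t \<in> L \<Longrightarrow> t \<le> b" using compact_attains_sup[OF L(1,2)] by blast
  have z: "\<phi> t = 0" if "t \<notin> {a..b}" for t
    using that a b L(4) by (intro K(3)) auto
  have "deriv \<phi> t = 0" if "t \<notin> {a..b}" for t
  proof -
    have "((\<lambda>_. 0) has_real_derivative 0) (at t)" by simp
    then have "(\<phi> has_real_derivative 0) (at t)"
      by (rule has_field_derivative_transform_within_open[of _ _ _ "- {a..b}"])
         (use that z in \<open>auto simp: open_Compl\<close>)
    then show ?thesis by (rule DERIV_imp_deriv)
  qed
  moreover have "a < b" using a(2)[OF L(5)] b(2)[OF L(6)] assms(2) by simp
  moreover have "0 < a" "b < l" using a(1) b(1) L(3) by auto
  ultimately show ?thesis using that[of a b] z by blast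
qed

lemma DERIV_rescale:
  fixes \<psi> :: "real \<Rightarrow> real"
  assumes "\<And>t. (\<psi> has_real_derivative \<eta> t) (at t)"
  shows "((\<lambda>t. \<psi> ((t - z) / e)) has_real_derivative \<eta> ((t - z) / e) / e) (at t)"
proof -
  have "((\<lambda>t. (t - z) / e) has_real_derivative 1 / e) (at t)"
    by (intro DERIV_cdivide) (auto intro!: derivative_eq_intros)
  from DERIV_chain2[OF assms this] show ?thesis by simp
qed

text \<open>
  Test functions that approximate the indicator of \<open>{x<..y}\<close> as \<open>e\<close> tends to zero, while their
  derivatives approximate the difference of the point masses at \<open>x\<close> and \<open>y\<close>.
\<close>
lemma smooth_trapezoid:
  assumes \<psi>: "\<And>t. (\<psi> has_real_derivative \<eta> t) (at t)" "\<And>k. Ck_on k UNIV \<eta>"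
    "\<And>t. t \<le> 0 \<Longrightarrow> \<psi> t = 0" "\<And>t. 1 \<le> t \<Longrightarrow> \<psi> t = 1"
    and x: "0 < x" "x < y" "0 < e" "y + e < l"
  defines "\<phi> \<equiv> \<lambda>t. \<psi> ((t - x) / e) - \<psi> ((t - y) / e)"
  shows "test_function l \<phi>" "deriv \<phi> t = \<eta> ((t - x) / e) / e - \<eta> ((t - y) / e) / e"
proof -
  have d: "(\<phi> has_real_derivative (\<eta> ((t - x) / e) / e - \<eta> ((t - y) / e) / e)) (at t)" for t
    unfolding \<phi>_def by (intro DERIV_diff DERIV_rescale \<psi>(1))
  then show "deriv \<phi> t = \<eta> ((t - x) / e) / e - \<eta> ((t - y) / e) / e" by (rule DERIV_imp_deriv)
  have aff: "Ck_on k UNIV (\<lambda>t. c * \<eta> ((t - z) / e))" for k z c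
    using Ck_on_mult[OF Ck_on_const[of k UNIV c] Ck_on_affine[OF \<psi>(2), of k "1/e" "-z/e"]]
    by (simp add: diff_divide_distrib)
  have "Ck_on k UNIV (\<lambda>t. \<eta> ((t - x) / e) / e - \<eta> ((t - y) / e) / e)" for k
    using Ck_on_add[OF aff[of k "1/e" x] aff[of k "-1/e" y]] by simp
  with d have S: "Ck_on (Suc k) UNIV \<phi>" for k by (intro Ck_on_UNIV_SucI)
  then have C: "Ck_on k UNIV \<phi>" for k by (rule Ck_on_SucD)
  have "\<phi> t = 0" if "t \<notin> {x..y+e}" for t
  proof (cases "t < x")
    case True then show ?thesis using x by (simp add: \<phi>_def \<psi>(3) divide_nonpos_pos)
  next
    case False then show ?thesis using x that by (simp add: \<phi>_def \<psi>(4) le_divide_eq)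
  qed
  then have s: "{t. \<phi> t \<noteq> 0} \<subseteq> {x..y+e}" by blast
  then have "closure {t. \<phi> t \<noteq> 0} \<subseteq> {x..y+e}" by (rule closure_minimal) auto
  moreover have "compact (closure {t. \<phi> t \<noteq> 0})"
    using bounded_subset[OF _ s] by (simp add: compact_closure)
  ultimately show "test_function l \<phi>" using x C by (auto simp: test_function_def)
qed

section \<open>Weak derivatives as integrals\<close>

lemma locally_integrable_interval:
  assumes "locally_integrable l g" "0 < a" "b < l"
  shows "integrable (lebesgue_on {a..b}) g"
proof -
  have "compact {a..b}" "{a..b} \<subseteq> {0<..<l}" using assms by auto
  then show ?thesis using assms(1) unfolding locally_integrable_def by blast
qed

lemma integrable_times_compact_support:
  fixes f g :: "real \<Rightarrow> real"
  assumes "locally_integrable l g" "continuous_on UNIV f" "0 < a" "b < l" "\<And>t. t \<notin> {a..b} \<Longrightarrow> f t = 0"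
  shows "integrable (lebesgue_on {0<..<l}) (\<lambda>t. g t * f t)"
proof -
  have g: "integrable (lebesgue_on {a..b}) g" by (rule locally_integrable_interval) fact+
  have "continuous_on {a..b} f" using assms(2) continuous_on_subset by blast
  then obtain B where B: "\<And>t. t \<in> {a..b} \<Longrightarrow> \<bar>f t\<bar> \<le> B"
    using compact_imp_bounded[OF compact_continuous_image[of "{a..b}" f]] by (force simp: bounded_iff)
  have "integrable (lebesgue_on {a..b}) (\<lambda>t. g t * f t)"
  proof (rule Bochner_Integration.integrable_bound)
    show "integrable (lebesgue_on {a..b}) (\<lambda>t. B * g t)" using g by simp
    show "(\<lambda>t. g t * f t) \<in> borel_measurable (lebesgue_on {a..b})"
      using g continuous_imp_measurable_on_sets_lebesgue[OF \<open>continuous_on {a..b} f\<close>]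
      by (intro borel_measurable_times) auto
    show "AE t in lebesgue_on {a..b}. norm (g t * f t) \<le> norm (B * g t)"
    proof (rule AE_I2)
      fix t assume "t \<in> space (lebesgue_on {a..b})"
      then have "\<bar>f t\<bar> \<le> \<bar>B\<bar>" using B[of t] by auto
      from mult_left_mono[OF this, of "\<bar>g t\<bar>"] show "norm (g t * f t) \<le> norm (B * g t)"
        by (simp add: abs_mult mult.commute)
    qed
  qed
  then have "integrable lebesgue (\<lambda>t. if t \<in> {a..b} then g t * f t else 0)"
    by (intro Lebesgue_Measure.integrable_restrict_UNIV[THEN iffD2]) auto
  also have "(\<lambda>t. if t \<in> {a..b} then g t * f t else 0) = (\<lambda>t. if t \<in> {0<..<l} then g t * f t else 0)"
    using assms by (auto simp: fun_eq_iff)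
  finally show ?thesis by (rule Lebesgue_Measure.integrable_restrict_UNIV[THEN iffD1, rotated]) auto
qed

text \<open>
  The kernel \<open>\<eta>((t - x)/e)/e\<close> is nonnegative, has integral one by the fundamental theorem applied to
  \<open>\<psi>\<close>, and lives on \<open>{x..x + e}\<close>, where \<open>u\<close> is close to \<open>u x\<close>.
\<close>
lemma approximate_identity:
  assumes \<psi>: "\<And>t. (\<psi> has_real_derivative \<eta> t) (at t)" "continuous_on UNIV \<eta>" "\<And>t. 0 \<le> \<eta> t"
    "\<psi> 0 = 0" "\<psi> 1 = 1" "\<And>t. t \<le> 0 \<or> 1 \<le> t \<Longrightarrow> \<eta> t = 0"
    and u: "locally_integrable l u" "isCont u x" and x: "0 < x" "x < l"
    and e: "e \<longlonglongrightarrow> 0" "\<And>n. 0 < e n" "\<And>n. x + e n < l"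
  shows "(\<lambda>n. LINT t|lebesgue_on {0<..<l}. u t * (\<eta> ((t - x) / e n) / e n)) \<longlonglongrightarrow> u x"
proof (rule LIMSEQ_I)
  fix r :: real assume "0 < r"
  then obtain d where d: "d > 0" "\<And>t. \<bar>t - x\<bar> < d \<Longrightarrow> \<bar>u t - u x\<bar> < r / 2"
    using u(2) unfolding isCont_def LIM_eq
    by (metis abs_0 diff_0_right diff_self half_gt_zero real_norm_def)
  from e(1) d(1) obtain N where N: "\<And>n. n \<ge> N \<Longrightarrow> e n < d"
    unfolding LIMSEQ_iff using e(2) by (metis abs_of_pos diff_0_right real_norm_def)
  have "norm ((LINT t|lebesgue_on {0<..<l}. u t * (\<eta> ((t - x) / e n) / e n)) - u x) < r" if "n \<ge> N" for n
  proof -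
    define w where "w t = \<eta> ((t - x) / e n) / e n" for t
    have en: "0 < e n" "e n < d" "x + e n < l" using e N[OF that] by auto
    have w0: "w t = 0" if "t \<notin> {x..x + e n}" for t
      unfolding w_def using that en \<psi>(6)[of "(t - x) / e n"]
      by (auto simp: divide_le_0_iff le_divide_eq)
    have wnn: "w t \<ge> 0" for t using \<psi>(3) en by (simp add: w_def)
    have wc: "continuous_on UNIV w" unfolding w_def
      by (intro continuous_intros continuous_on_compose2[OF \<psi>(2)]) (use en in auto)
    have "locally_integrable l (\<lambda>t. 1)"
      unfolding locally_integrable_def
      by (auto intro!: finite_measure.integrable_const finite_measure_lebesgue_on simp: lmeasurable_compact)
    from integrable_times_compact_support[OF this wc x(1) en(3) w0]
    have wi: "integrable (lebesgue_on {0<..<l}) w" by simp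
    have uwi: "integrable (lebesgue_on {0<..<l}) (\<lambda>t. u t * w t)"
      by (rule integrable_times_compact_support[OF u(1) wc x(1) en(3) w0])
    have "(w has_integral (\<psi> ((x + e n - x) / e n) - \<psi> ((x - x) / e n))) {x..x + e n}"
    proof (rule fundamental_theorem_of_calculus)
      fix t
      have "((\<lambda>t. \<psi> ((t - x) / e n)) has_real_derivative w t) (at t)"
        unfolding w_def by (intro DERIV_rescale \<psi>(1))
      then show "((\<lambda>t. \<psi> ((t - x) / e n)) has_vector_derivative w t) (at t within {x..x + e n})"
        by (simp add: has_real_derivative_iff_has_vector_derivative has_vector_derivative_at_within)
    qed (use en in simp)
    then have "(w has_integral 1) {x..x + e n}" using en \<psi>(4,5) by simp
    then have "(w has_integral 1) {0<..<l}"
      by (rule has_integral_on_superset) (use w0 x en in auto)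
    then have w1: "(LINT t|lebesgue_on {0<..<l}. w t) = 1"
      using wi by (simp add: lebesgue_integral_eq_integral integral_unique)
    have "(LINT t|lebesgue_on {0<..<l}. u t * w t) - u x = (LINT t|lebesgue_on {0<..<l}. u t * w t - u x * w t)"
      using uwi wi w1 by simp
    moreover have "norm (LINT t|lebesgue_on {0<..<l}. u t * w t - u x * w t) \<le> (LINT t|lebesgue_on {0<..<l}. (r/2) * w t)"
    proof (rule Bochner_Integration.integral_norm_bound_integral)
      fix t
      show "norm (u t * w t - u x * w t) \<le> r / 2 * w t"
      proof (cases "t \<in> {x..x + e n}")
        case True
        then have "\<bar>u t - u x\<bar> \<le> r / 2" using d(2)[of t] en by auto
        from mult_right_mono[OF this wnn[of t]] show ?thesis
          using wnn[of t] by (simp add: abs_mult left_diff_distrib[symmetric])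
      qed (simp add: w0)
    qed (use uwi wi in auto)
    ultimately show ?thesis using w1 \<open>0 < r\<close> by (simp add: w_def)
  qed
  then show "\<exists>no. \<forall>n\<ge>no. norm ((LINT t|lebesgue_on {0<..<l}. u t * (\<eta> ((t - x) / e n) / e n)) - u x) < r"
    by blast
qed

text \<open>
  Test the weak derivative with smooth trapezoids. On the side of \<open>u\<close> their derivatives are two
  approximate identities, with limit \<open>u x - u y\<close>; on the side of \<open>g\<close> dominated convergence gives the
  integral over \<open>{x<..y}\<close>.
\<close>
lemma weak_deriv_FTC:
  assumes w: "has_weak_deriv l u g" and u: "continuous_on {0..l} u" and x: "0 < x" "x < y" "y < l"
  shows "u y - u x = (LINT t|lebesgue_on {x..y}. g t)"
proof -
  obtain \<psi> \<eta> :: "real \<Rightarrow> real" where \<psi>: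
    "\<And>t. (\<psi> has_real_derivative \<eta> t) (at t)" "\<And>k. Ck_on k UNIV \<eta>"
    "\<And>t. 0 \<le> \<eta> t" "\<And>t. t \<le> 0 \<Longrightarrow> \<psi> t = 0" "\<And>t. 1 \<le> t \<Longrightarrow> \<psi> t = 1"
    "\<And>t. t \<le> 0 \<or> 1 \<le> t \<Longrightarrow> \<eta> t = 0"
    by (rule smooth_step_exists) blast
  have \<eta>: "continuous_on UNIV \<eta>" using \<psi>(2)[of 0] by simp
  have mono: "\<psi> s \<le> \<psi> t" if "s \<le> t" for s t
    using DERIV_nonneg_imp_nondecreasing[OF that, of \<psi>] \<psi>(1,3) by blast
  have bd: "0 \<le> \<psi> t" "\<psi> t \<le> 1" for t
    using mono[of "min t 0" t] mono[of t "max t 1"] \<psi>(4)[of "min t 0"] \<psi>(5)[of "max t 1"] by auto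
  have li: "locally_integrable l u" "locally_integrable l g" using w by (auto simp: has_weak_deriv_def)
  have cont: "isCont u z" if "0 < z" "z < l" for z
    using u that continuous_on_interior[of "{0..l}" u z] by simp
  \<comment> \<open>Small enough that all trapezoids live in \<open>{x..(y + l) / 2}\<close>, a fixed compact set.\<close>
  define e where "e n = (l - y) / 2 * inverse (real (Suc n))" for n
  have e0: "e \<longlonglongrightarrow> 0" unfolding e_def using tendsto_mult_right_zero[OF LIMSEQ_inverse_real_of_nat] by simp
  have e: "0 < e n" "y + e n \<le> (y + l) / 2" for n
  proof -
    show "0 < e n" using x by (simp add: e_def)
    have "e n \<le> (l - y) / 2" using x unfolding e_def
      by (intro mult_left_le) (auto simp: inverse_le_1_iff)
    then show "y + e n \<le> (y + l) / 2" by (simp add: field_simps)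
  qed
  have el: "y + e n < l" for n using e(2)[of n] x by simp
  have xel: "x + e n < l" for n using el[of n] x by linarith
  define \<phi> where "\<phi> n t = \<psi> ((t - x) / e n) - \<psi> ((t - y) / e n)" for n t
  have test: "test_function l (\<phi> n)" and d\<phi>: "deriv (\<phi> n) t = \<eta> ((t - x) / e n) / e n - \<eta> ((t - y) / e n) / e n" for n t
    unfolding \<phi>_def using smooth_trapezoid[OF \<psi>(1,2,4,5) x(1,2) e(1)[of n] el[of n]] by auto
  have \<phi>0: "\<phi> n t = 0" if "t \<notin> {x..(y+l)/2}" for n t
    using that e[of n] x
    by (cases "t < x") (simp_all add: \<phi>_def \<psi>(4,5) divide_nonpos_pos le_divide_eq)
  have \<phi>1: "\<bar>\<phi> n t\<bar> \<le> 1" for n t using bd[of "(t - x) / e n"] bd[of "(t - y) / e n"] by (simp add: \<phi>_def)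
  have \<phi>lim: "(\<lambda>n. \<phi> n t) \<longlonglongrightarrow> indicator {x<..y} t" for t
  proof -
    have lim: "(\<lambda>n. \<psi> ((t - z) / e n)) \<longlonglongrightarrow> (if z < t then 1 else 0)" for z
    proof (cases "z < t")
      case False
      then have "\<psi> ((t - z) / e n) = 0" for n using e(1)[of n] by (intro \<psi>(4)) (simp add: divide_nonpos_pos)
      with False show ?thesis by simp
    next
      case True
      then have "eventually (\<lambda>n. e n < t - z) sequentially"
        using order_tendstoD(2)[OF e0] by simp
      then have "eventually (\<lambda>n. \<psi> ((t - z) / e n) = 1) sequentially"
      proof eventually_elim
        case (elim n)
        then show ?case using e(1)[of n] by (intro \<psi>(5)) (simp add: le_divide_eq)
      qed
      with True show ?thesis by (simp add: tendsto_eventually)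
    qed
    have "(\<lambda>n. \<phi> n t) \<longlonglongrightarrow> (if x < t then 1 else 0) - (if y < t then 1 else 0)"
      unfolding \<phi>_def by (intro tendsto_intros lim)
    also have "(if x < t then 1 else 0) - (if y < t then 1 else 0) = (indicator {x<..y} t :: real)"
      using x by (auto simp: indicator_def)
    finally show ?thesis .
  qed
  have \<eta>0: "\<eta> ((t - z) / e n) / e n = 0" if "t \<notin> {z..z + e n}" for t z n
    using that e(1)[of n] \<psi>(6)[of "(t - z) / e n"] by (auto simp: divide_le_0_iff le_divide_eq)
  have ui: "integrable (lebesgue_on {0<..<l}) (\<lambda>t. u t * (\<eta> ((t - z) / e n) / e n))" if "0 < z" "z \<le> y" for z n
  proof (rule integrable_times_compact_support[OF li(1) _ that(1) _ \<eta>0])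
    show "continuous_on UNIV (\<lambda>t. \<eta> ((t - z) / e n) / e n)"
      using e(1)[of n] by (intro continuous_intros continuous_on_compose2[OF \<eta>]) auto
    show "z + e n < l" using that el[of n] by simp
  qed
  have "(LINT t|lebesgue_on {0<..<l}. u t * deriv (\<phi> n) t)
     = (LINT t|lebesgue_on {0<..<l}. u t * (\<eta> ((t - x) / e n) / e n))
     - (LINT t|lebesgue_on {0<..<l}. u t * (\<eta> ((t - y) / e n) / e n))" for n
    using ui[of x n] ui[of y n] x by (simp add: d\<phi> right_diff_distrib)
  moreover have "(\<lambda>n. (LINT t|lebesgue_on {0<..<l}. u t * (\<eta> ((t - x) / e n) / e n))
     - (LINT t|lebesgue_on {0<..<l}. u t * (\<eta> ((t - y) / e n) / e n))) \<longlonglongrightarrow> u x - u y"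
    by (intro tendsto_diff approximate_identity[of \<psi> \<eta>] \<psi>(1,3,6) \<eta> li cont e0 e(1))
       (use x \<psi>(4,5) el xel in auto)
  ultimately have 1: "(\<lambda>n. LINT t|lebesgue_on {0<..<l}. u t * deriv (\<phi> n) t) \<longlonglongrightarrow> u x - u y" by simp
  have gi: "integrable (lebesgue_on {x..(y+l)/2}) g" by (rule locally_integrable_interval[OF li(2)]) (use x in auto)
  have 2: "(\<lambda>n. LINT t|lebesgue_on {x..(y+l)/2}. g t * \<phi> n t) \<longlonglongrightarrow> (LINT t|lebesgue_on {x..(y+l)/2}. (if t \<in> {x..y} then g t else 0))"
  proof (rule integral_dominated_convergence)
    show "integrable (lebesgue_on {x..(y+l)/2}) (\<lambda>t. \<bar>g t\<bar>)" using gi by simp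
    \<comment> \<open>The trapezoids tend to the indicator of the half-open interval, which misses \<open>x\<close>.\<close>
    have "AE t in lebesgue. t \<noteq> x" by (intro AE_completion AE_lborel_singleton)
    then have "AE t in lebesgue_on {x..(y+l)/2}. t \<noteq> x"
      by (subst AE_restrict_space_iff) auto
    then show "AE t in lebesgue_on {x..(y+l)/2}. (\<lambda>n. g t * \<phi> n t) \<longlonglongrightarrow> (if t \<in> {x..y} then g t else 0)"
    proof eventually_elim
      case (elim t)
      then have "(if t \<in> {x..y} then g t else 0) = g t * indicator {x<..y} t" by (auto simp: indicator_def)
      then show ?case by (simp only:) (intro tendsto_intros \<phi>lim)
    qed
    show "AE t in lebesgue_on {x..(y+l)/2}. norm (g t * \<phi> n t) \<le> \<bar>g t\<bar>" for n
      using mult_left_mono[OF \<phi>1[of n], of "\<bar>g _\<bar>"] by (intro AE_I2) (simp add: abs_mult)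
    show "(\<lambda>t. g t * \<phi> n t) \<in> borel_measurable (lebesgue_on {x..(y+l)/2})" for n
      using gi continuous_imp_measurable_on_sets_lebesgue[OF continuous_on_subset[OF test_function_C1(2)[OF test[of n]]], of "{x..(y+l)/2}"]
      by (intro borel_measurable_times) auto
    show "(\<lambda>t. if t \<in> {x..y} then g t else 0) \<in> borel_measurable (lebesgue_on {x..(y+l)/2})"
      using gi by (intro measurable_If_set) (auto simp: sets_restrict_space)
  qed
  have "(LINT t|lebesgue_on {0<..<l}. u t * deriv (\<phi> n) t) = - (LINT t|lebesgue_on {x..(y+l)/2}. g t * \<phi> n t)" for n
  proof -
    have "(LINT t|lebesgue_on {0<..<l}. g t * \<phi> n t) = (LINT t|lebesgue_on {0<..<l}. (if t \<in> {x..(y+l)/2} then g t * \<phi> n t else 0))"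
      using \<phi>0 by (intro Bochner_Integration.integral_cong) auto
    also have "\<dots> = (LINT t|lebesgue_on {x..(y+l)/2}. g t * \<phi> n t)"
      by (rule integral_restrict) (use x in auto)
    finally show ?thesis using w test by (simp add: has_weak_deriv_def)
  qed
  with 1 have "(\<lambda>n. - (LINT t|lebesgue_on {x..(y+l)/2}. g t * \<phi> n t)) \<longlonglongrightarrow> u x - u y" by simp
  from tendsto_minus[OF this] have "(\<lambda>n. LINT t|lebesgue_on {x..(y+l)/2}. g t * \<phi> n t) \<longlonglongrightarrow> u y - u x" by simp
  then have "u y - u x = (LINT t|lebesgue_on {x..(y+l)/2}. (if t \<in> {x..y} then g t else 0))"
    using 2 LIMSEQ_unique by blast
  also have "\<dots> = (LINT t|lebesgue_on {x..y}. g t)"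
    by (rule integral_restrict) (use x in auto)
  finally show ?thesis .
qed

text \<open>
  The difference of two weak derivatives has zero integral over every compact subinterval by
  \<open>weak_deriv_FTC\<close>, hence it vanishes at almost every point by Lebesgue differentiation. As the
  difference is only locally integrable, this is applied to its restrictions to an exhausting
  sequence of compact intervals.
\<close>
lemma weak_deriv_unique:
  assumes "has_weak_deriv l u g" "has_weak_deriv l u g'" "continuous_on {0..l} u"
  shows "AE t in lebesgue_on {0<..<l}. g t = g' t"
proof -
  define K where "K n = {1 / real (Suc n)..l - 1 / real (Suc n)}" for n
  define k where "k n t = (if t \<in> K n then g t - g' t else 0)" for n t
  have li: "locally_integrable l g" "locally_integrable l g'" using assms by (auto simp: has_weak_deriv_def)
  have hi: "(k n has_integral 0) {a..b}" for n a b
  proof -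
    have *: "{a..b} \<inter> K n = {max a (1 / real (Suc n))..min b (l - 1 / real (Suc n))}" (is "_ = {?a..?b}")
      by (auto simp: K_def)
    have "((\<lambda>t. g t - g' t) has_integral 0) {?a..?b}"
    proof (cases "?a < ?b")
      case True
      have ab: "0 < ?a" "?b < l" by (auto simp: less_max_iff_disj min_less_iff_disj)
      then have i: "integrable (lebesgue_on {?a..?b}) g" "integrable (lebesgue_on {?a..?b}) g'"
        using li locally_integrable_interval by blast+
      from has_integral_integral_lebesgue_on[of "{?a..?b}" "\<lambda>t. g t - g' t"] i
        weak_deriv_FTC[OF assms(1,3) ab(1) True ab(2)] weak_deriv_FTC[OF assms(2,3) ab(1) True ab(2)]
      show ?thesis by simp
    next
      case False
      then show ?thesis by (intro has_integral_null_real) auto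
    qed
    then have "((\<lambda>t. g t - g' t) has_integral 0) (K n \<inter> {a..b})"
      unfolding *[symmetric] by (simp add: Int_commute)
    then show ?thesis unfolding k_def by (subst has_integral_restrict_Int)
  qed
  have "AE t in lebesgue. k n t = 0" for n
  proof -
    have ki: "\<And>a b. k n integrable_on cbox a b" using hi by (auto simp: integrable_on_def)
    obtain N where N: "negligible N" "\<And>x e. \<lbrakk>x \<notin> N; 0 < e\<rbrakk> \<Longrightarrow>
               \<exists>d>0. \<forall>h. 0 < h \<and> h < d \<longrightarrow>
                         norm (integral (cbox x (x + h *\<^sub>R One)) (k n) /\<^sub>R h ^ DIM(real) - k n x) < e"
      using integrable_ccontinuous_explicit[OF ki] by blast
    have "k n t = 0" if "t \<notin> N" for t
    proof (rule ccontr)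
      assume "k n t \<noteq> 0"
      with N(2)[OF that, of "\<bar>k n t\<bar>"] obtain d where "d > 0" and
        d: "\<And>h. 0 < h \<and> h < d \<Longrightarrow> norm (integral (cbox t (t + h *\<^sub>R One)) (k n) /\<^sub>R h ^ DIM(real) - k n t) < \<bar>k n t\<bar>"
        by auto
      from d[of "d/2"] \<open>d > 0\<close> show False
        using integral_unique[OF hi[of n t "t + d/2"]] by simp
    qed
    then show ?thesis using N(1)
      by (intro AE_I'[of N]) (auto simp: negligible_iff_null_sets)
  qed
  then have "AE t in lebesgue. \<forall>n. k n t = 0" by (simp add: AE_all_countable)
  then have "AE t in lebesgue. t \<in> {0<..<l} \<longrightarrow> g t = g' t"
  proof (rule AE_mp, intro AE_I2 impI)
    fix t assume k: "\<forall>n. k n t = 0" and t: "t \<in> {0<..<l}"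
    then obtain n where "1 / real (Suc n) < min t (l - t)"
      using nat_approx_posE[of "min t (l - t)"] by auto
    then have "t \<in> K n" by (auto simp: K_def)
    with k show "g t = g' t" unfolding k_def by (metis eq_iff_diff_eq_0)
  qed
  then show ?thesis by (subst AE_restrict_space_iff) auto
qed

section \<open>Convex combinations of tails of sequences bounded in L2\<close>

text \<open>
  Coefficients of a convex combination of the members \<open>n\<close> to \<open>N\<close> of a sequence. The upper end \<open>N\<close> is
  part of the predicate, and sums run over \<open>{..N}\<close>, so that combinations of different lengths can be
  brought to a common range.
\<close>
definition convex_weights :: "nat \<Rightarrow> nat \<Rightarrow> (nat \<Rightarrow> real) \<Rightarrow> bool" where
  "convex_weights n N w \<longleftrightarrow> (\<forall>i. 0 \<le> w i) \<and> (\<forall>i. i < n \<or> N < i \<longrightarrow> w i = 0) \<and> (\<Sum>i\<le>N. w i) = 1"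

lemma convex_weights_sum_extend:
  fixes f :: "nat \<Rightarrow> real"
  assumes "convex_weights n N w" "N \<le> N'"
  shows "(\<Sum>i\<le>N'. w i * f i) = (\<Sum>i\<le>N. w i * f i)"
  using assms by (intro sum.mono_neutral_right) (auto simp: convex_weights_def)

lemma convex_weights_mono:
  assumes "convex_weights n N w" "N \<le> N'" "n' \<le> n"
  shows "convex_weights n' N' w"
  using convex_weights_sum_extend[OF assms(1,2), of "\<lambda>_. 1"] assms by (auto simp: convex_weights_def)

lemma convex_weights_midpoint:
  assumes "convex_weights n N v" "convex_weights n N w"
  shows "convex_weights n N (\<lambda>i. (v i + w i) / 2)"
  using assms by (auto simp: convex_weights_def sum.distrib simp flip: sum_divide_distrib)

text \<open>
  Combinations of tails inherit limits: the \<open>k\<close>-th one only involves members from index \<open>k\<close> on.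
\<close>
lemma convex_weights_tendsto:
  fixes x :: "nat \<Rightarrow> real"
  assumes "x \<longlonglongrightarrow> c" "\<And>k. convex_weights k (N k) (w k)"
  shows "(\<lambda>k. \<Sum>i\<le>N k. w k i * x i) \<longlonglongrightarrow> c"
proof (rule LIMSEQ_I)
  fix r :: real assume "r > 0"
  with assms(1) obtain K where K: "\<And>i. i \<ge> K \<Longrightarrow> \<bar>x i - c\<bar> < r / 2"
    using LIMSEQ_D[of x c "r/2"] by auto
  have "norm ((\<Sum>i\<le>N k. w k i * x i) - c) < r" if "k \<ge> K" for k
  proof -
    have w: "(\<Sum>i\<le>N k. w k i) = 1" "\<And>i. 0 \<le> w k i" "\<And>i. i < k \<Longrightarrow> w k i = 0"
      using assms(2)[of k] by (auto simp: convex_weights_def)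
    have "(\<Sum>i\<le>N k. w k i * x i) - c = (\<Sum>i\<le>N k. w k i * (x i - c))"
      using w(1) by (simp add: right_diff_distrib sum_subtractf flip: sum_distrib_right)
    also have "norm \<dots> \<le> (\<Sum>i\<le>N k. w k i * (r / 2))"
    proof (rule sum_norm_le)
      fix i
      show "norm (w k i * (x i - c)) \<le> w k i * (r / 2)"
      proof (cases "i < k")
        case False
        then have "\<bar>x i - c\<bar> \<le> r / 2" using K[of i] that by auto
        from mult_left_mono[OF this w(2)[of i]] show ?thesis using w(2)[of i] by (simp add: abs_mult)
      qed (simp add: w(3))
    qed
    also have "\<dots> = r / 2" by (subst sum_distrib_right[symmetric]) (simp add: w(1))
    finally show ?thesis using \<open>r > 0\<close> by simp
  qed
  then show "\<exists>no. \<forall>n\<ge>no. norm ((\<Sum>i\<le>N n. w n i * x i) - c) < r" by blast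
qed

lemma square_integrable_mult:
  fixes f g :: "'a \<Rightarrow> real"
  assumes [measurable]: "f \<in> borel_measurable M" "g \<in> borel_measurable M"
    and "integrable M (\<lambda>x. (f x)\<^sup>2)" "integrable M (\<lambda>x. (g x)\<^sup>2)"
  shows "integrable M (\<lambda>x. f x * g x)"
proof (rule Bochner_Integration.integrable_bound)
  show "integrable M (\<lambda>x. (f x)\<^sup>2 + (g x)\<^sup>2)" using assms by simp
  show "AE x in M. norm (f x * g x) \<le> norm ((f x)\<^sup>2 + (g x)\<^sup>2)"
  proof (rule AE_I2)
    fix x
    have "2 * (\<bar>f x\<bar> * \<bar>g x\<bar>) \<le> (f x)\<^sup>2 + (g x)\<^sup>2"
      using sum_squares_bound[of "\<bar>f x\<bar>" "\<bar>g x\<bar>"] by simp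
    moreover have "0 \<le> \<bar>f x\<bar> * \<bar>g x\<bar>" by simp
    ultimately have "\<bar>f x\<bar> * \<bar>g x\<bar> \<le> (f x)\<^sup>2 + (g x)\<^sup>2" by linarith
    then show "norm (f x * g x) \<le> norm ((f x)\<^sup>2 + (g x)\<^sup>2)" by (simp add: abs_mult)
  qed
qed measurable

lemma square_integrable_lincomb:
  fixes f :: "nat \<Rightarrow> 'a \<Rightarrow> real"
  assumes [measurable]: "\<And>i. f i \<in> borel_measurable M" and "\<And>i. integrable M (\<lambda>x. (f i x)\<^sup>2)"
  shows "integrable M (\<lambda>x. (\<Sum>i\<in>I. w i * f i x)\<^sup>2)"
proof -
  have "integrable M (\<lambda>x. \<Sum>i\<in>I. \<Sum>j\<in>I. (w i * w j) * (f i x * f j x))"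
    using assms by (intro Bochner_Integration.integrable_sum integrable_mult_right square_integrable_mult) auto
  also have "(\<lambda>x. \<Sum>i\<in>I. \<Sum>j\<in>I. (w i * w j) * (f i x * f j x)) = (\<lambda>x. (\<Sum>i\<in>I. w i * f i x)\<^sup>2)"
    by (simp add: power2_eq_square sum_product mult_ac)
  finally show ?thesis .
qed

text \<open>
  Let \<open>d\<^sub>n\<close> be the infimum of the squared norm over the combinations of the \<open>n\<close>-th tail. The sequence
  \<open>d\<^sub>n\<close> increases and is bounded, so it converges. Combinations that nearly attain \<open>d\<^sub>n\<close> are Cauchy: by
  the parallelogram law two of them with a large distance would have a midpoint of norm below the
  infimum.
\<close>
lemma tail_convex_combinations_Cauchy_L2:
  fixes f :: "nat \<Rightarrow> 'a \<Rightarrow> real"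
  assumes [measurable]: "\<And>i. f i \<in> borel_measurable M" and I: "\<And>i. integrable M (\<lambda>x. (f i x)\<^sup>2)"
    and C: "\<And>i. (LINT x|M. (f i x)\<^sup>2) \<le> C"
  obtains w N where "\<And>n. convex_weights n (N n) (w n)"
    "\<And>r. r > 0 \<Longrightarrow> \<exists>n0. \<forall>n\<ge>n0. \<forall>m\<ge>n0.
       (LINT x|M. ((\<Sum>i\<le>N n. w n i * f i x) - (\<Sum>i\<le>N m. w m i * f i x))\<^sup>2) < r"
proof -
  define Q where "Q N w = (LINT x|M. (\<Sum>i\<le>N. w i * f i x)\<^sup>2)" for N w
  define D where "D n = {Q N w |N w. convex_weights n N w}" for n
  have Q0: "Q N w \<ge> 0" for N w unfolding Q_def by simp
  have bdd: "bdd_below (D n)" for n using Q0 by (auto simp: D_def intro!: bdd_belowI[of _ 0])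
  have DQ: "Inf (D n) \<le> Q N w" if "convex_weights n N w" for n N w
    using that by (intro cInf_lower bdd) (auto simp: D_def)
  have unit: "Q n (\<lambda>i. if i = n then 1 else 0) \<in> D n" "Q n (\<lambda>i. if i = n then 1 else 0) \<le> C" for n
  proof -
    have "convex_weights n n (\<lambda>i. if i = n then 1 else 0)" by (auto simp: convex_weights_def)
    then show "Q n (\<lambda>i. if i = n then 1 else 0) \<in> D n" by (auto simp: D_def)
    have "(\<Sum>i\<le>n. (if i = n then 1 else 0) * f i x) = f n x" for x
      by (subst sum.cong[OF refl, of _ _ "\<lambda>i. if i = n then f i x else 0"]) auto
    then show "Q n (\<lambda>i. if i = n then 1 else 0) \<le> C" using C[of n] by (simp add: Q_def)
  qed
  have "incseq (\<lambda>n. Inf (D n))"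
  proof (rule incseq_SucI)
    fix n
    show "Inf (D n) \<le> Inf (D (Suc n))"
    proof (intro cInf_superset_mono bdd)
      show "D (Suc n) \<subseteq> D n"
      proof -
        have "convex_weights n N w" if "convex_weights (Suc n) N w" for N w
          using convex_weights_mono[OF that order_refl, of n] by simp
        then show ?thesis unfolding D_def by blast
      qed
    qed (use unit(1) in blast)
  qed
  moreover have "Inf (D n) \<le> C" for n using cInf_lower[OF unit(1) bdd, of n] unit(2)[of n] by linarith
  ultimately obtain d where d: "(\<lambda>n. Inf (D n)) \<longlonglongrightarrow> d" "\<And>n. Inf (D n) \<le> d"
    using incseq_convergent[of "\<lambda>n. Inf (D n)" C] by auto
  have "\<exists>N w. convex_weights n N w \<and> Q N w < Inf (D n) + inverse (real (Suc n))" for n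
  proof -
    have "\<exists>q\<in>D n. q < Inf (D n) + inverse (real (Suc n))"
      using unit(1)[of n] bdd by (intro cInf_lessD) auto
    then show ?thesis by (auto simp: D_def)
  qed
  then obtain N w where w: "\<And>n. convex_weights n (N n) (w n)" and
    Qw: "\<And>n. Q (N n) (w n) < Inf (D n) + inverse (real (Suc n))" by metis
  have ineq: "(LINT x|M. ((\<Sum>i\<le>N n. w n i * f i x) - (\<Sum>i\<le>N m. w m i * f i x))\<^sup>2)
      \<le> 4 * (d - Inf (D k) + inverse (real (Suc k)))" if nm: "k \<le> n" "k \<le> m" for n m k
  proof -
    define L where "L = max (N n) (N m)"
    define G where "G v x = (\<Sum>i\<le>L. v i * f i x)" for v x
    have v: "convex_weights k L (w n)" "convex_weights k L (w m)"
      unfolding L_def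
      using convex_weights_mono[OF w[of n] _ nm(1), of "max (N n) (N m)"]
        convex_weights_mono[OF w[of m] _ nm(2), of "max (N n) (N m)"] by linarith+
    have Gn: "(\<Sum>i\<le>N n. w n i * f i x) = G (w n) x" "(\<Sum>i\<le>N m. w m i * f i x) = G (w m) x" for x
      unfolding G_def L_def
      by (rule convex_weights_sum_extend[OF w, symmetric], simp)+
    have Gi: "integrable M (\<lambda>x. (G v x)\<^sup>2)" for v
      unfolding G_def using I by (intro square_integrable_lincomb) auto
    have mid: "Inf (D k) \<le> (LINT x|M. (G (\<lambda>i. (w n i + w m i) / 2) x)\<^sup>2)"
      using DQ[OF convex_weights_midpoint[OF v]] by (simp only: Q_def G_def)
    \<comment> \<open>the parallelogram law, with the norm of the midpoint bounded below by the infimum\<close>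
    have par: "(G (w n) x - G (w m) x)\<^sup>2 = 2 * (G (w n) x)\<^sup>2 + 2 * (G (w m) x)\<^sup>2 - 4 * (G (\<lambda>i. (w n i + w m i) / 2) x)\<^sup>2" for x
    proof -
      have "G (\<lambda>i. (w n i + w m i) / 2) x = (G (w n) x + G (w m) x) / 2"
        by (simp add: G_def sum.distrib[symmetric] sum_divide_distrib distrib_right add_divide_distrib)
      then show ?thesis by (simp only:) (simp add: power2_eq_square field_simps)
    qed
    have "(LINT x|M. (G (w n) x - G (w m) x)\<^sup>2) = 2 * (LINT x|M. (G (w n) x)\<^sup>2) + 2 * (LINT x|M. (G (w m) x)\<^sup>2)
        - 4 * (LINT x|M. (G (\<lambda>i. (w n i + w m i) / 2) x)\<^sup>2)"
      unfolding par using Gi by simp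
    also have "(LINT x|M. (G (w n) x)\<^sup>2) = Q (N n) (w n)" by (simp add: Q_def Gn)
    also have "(LINT x|M. (G (w m) x)\<^sup>2) = Q (N m) (w m)" by (simp add: Q_def Gn)
    finally have e: "(LINT x|M. (G (w n) x - G (w m) x)\<^sup>2) \<le> 2 * Q (N n) (w n) + 2 * Q (N m) (w m) - 4 * Inf (D k)"
      using mid by linarith
    have "inverse (real (Suc n)) \<le> inverse (real (Suc k))" "inverse (real (Suc m)) \<le> inverse (real (Suc k))"
      using nm by (auto intro!: le_imp_inverse_le)
    then have "Q (N n) (w n) \<le> d + inverse (real (Suc k))" "Q (N m) (w m) \<le> d + inverse (real (Suc k))"
      using Qw[of n] Qw[of m] d(2)[of n] d(2)[of m] by linarith+
    then have "2 * Q (N n) (w n) + 2 * Q (N m) (w m) - 4 * Inf (D k) \<le> 4 * (d - Inf (D k) + inverse (real (Suc k)))"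
      by argo
    with e show ?thesis unfolding Gn by (rule order_trans)
  qed
  have lim: "(\<lambda>k. 4 * (d - Inf (D k) + inverse (real (Suc k)))) \<longlonglongrightarrow> 4 * (d - d + 0)"
    by (intro tendsto_intros d LIMSEQ_inverse_real_of_nat)
  show ?thesis
  proof (rule that[of N w, OF w])
    fix r :: real assume "r > 0"
    with order_tendstoD(2)[OF lim, of r] obtain k where "4 * (d - Inf (D k) + inverse (real (Suc k))) < r"
      by (auto simp: eventually_sequentially)
    then show "\<exists>n0. \<forall>n\<ge>n0. \<forall>m\<ge>n0.
       (LINT x|M. ((\<Sum>i\<le>N n. w n i * f i x) - (\<Sum>i\<le>N m. w m i * f i x))\<^sup>2) < r"
      using ineq by (meson le_less_trans)
  qed
qed

text \<open>
  The usual completeness argument: along a fast subsequence the increments have summable \<open>L\<^sup>1\<close> norms,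
  so the sum of their absolute values is integrable. It serves as the dominating function.
\<close>
lemma Cauchy_L2_AE_subseq:
  fixes G :: "nat \<Rightarrow> 'a \<Rightarrow> real"
  assumes "finite_measure M" and [measurable]: "\<And>n. G n \<in> borel_measurable M"
    and I: "\<And>n. integrable M (\<lambda>x. (G n x)\<^sup>2)"
    and Cauchy: "\<And>r. r > 0 \<Longrightarrow> \<exists>n0. \<forall>n\<ge>n0. \<forall>m\<ge>n0. (LINT x|M. (G n x - G m x)\<^sup>2) < r"
  obtains r g S where "strict_mono (r :: nat \<Rightarrow> nat)" "g \<in> borel_measurable M" "integrable M S"
    "AE x in M. (\<lambda>k. G (r k) x) \<longlonglongrightarrow> g x" "\<And>k. AE x in M. \<bar>G (r k) x\<bar> \<le> S x"
proof -
  interpret finite_measure M by fact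
  obtain \<nu> where \<nu>: "\<And>k n m. n \<ge> \<nu> k \<Longrightarrow> m \<ge> \<nu> k \<Longrightarrow> (LINT x|M. (G n x - G m x)\<^sup>2) < (1/4) ^ k"
  proof -
    have "\<exists>n0. \<forall>n\<ge>n0. \<forall>m\<ge>n0. (LINT x|M. (G n x - G m x)\<^sup>2) < (1/4) ^ k" for k :: nat
      by (rule Cauchy) simp
    then show ?thesis using that by metis
  qed
  \<comment> \<open>Summing makes \<open>r\<close> strictly increasing while keeping \<open>r k \<ge> \<nu> k\<close>.\<close>
  define r where "r k = (\<Sum>j\<le>k. Suc (\<nu> j))" for k
  have r: "strict_mono r" by (auto simp: strict_mono_Suc_iff r_def)
  have r\<nu>: "r k \<ge> \<nu> k" for k by (cases k) (auto simp: r_def)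
  have Gi: "integrable M (G n)" for n
  proof (rule Bochner_Integration.integrable_bound)
    show "integrable M (\<lambda>x. 1 + (G n x)\<^sup>2)" using I by simp
    show "AE x in M. norm (G n x) \<le> norm (1 + (G n x)\<^sup>2)"
    proof (rule AE_I2)
      fix x
      have "2 * \<bar>G n x\<bar> \<le> 1 + (G n x)\<^sup>2" using sum_squares_bound[of 1 "\<bar>G n x\<bar>"] by simp
      then show "norm (G n x) \<le> norm (1 + (G n x)\<^sup>2)" by simp
    qed
  qed measurable
  define \<Delta> where "\<Delta> k x = G (r (Suc k)) x - G (r k) x" for k x
  have \<Delta>i: "integrable M (\<Delta> k)" for k unfolding \<Delta>_def using Gi by simp
  have \<Delta>2: "integrable M (\<lambda>x. (\<Delta> k x)\<^sup>2)" for k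
  proof -
    have "integrable M (\<lambda>x. (G (r (Suc k)) x)\<^sup>2 + (G (r k) x)\<^sup>2 - 2 * (G (r (Suc k)) x * G (r k) x))"
      using I square_integrable_mult[of "G (r (Suc k))" M "G (r k)"] by auto
    then show ?thesis by (simp add: \<Delta>_def power2_diff mult.assoc)
  qed
  have \<Delta>b: "(LINT x|M. \<bar>\<Delta> k x\<bar>) \<le> (1/2)^k * (measure M (space M) + 1)" for k
  proof -
    \<comment> \<open>With the weight \<open>2^k\<close> both terms have integrals of order \<open>(1/2)^k\<close>, as \<open>\<Delta> k\<close> has squared norm below \<open>(1/4)^k\<close>.\<close>
    have *: "\<bar>\<Delta> k x\<bar> \<le> (1/2)^k + 2^k * (\<Delta> k x)\<^sup>2" for x
    proof -
      have "0 \<le> (1 - 2^k * \<bar>\<Delta> k x\<bar>)\<^sup>2" by simp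
      then have "2 * (2^k * \<bar>\<Delta> k x\<bar>) \<le> 1 + (2^k)\<^sup>2 * (\<Delta> k x)\<^sup>2"
        by (simp add: power2_diff power_mult_distrib)
      moreover have "0 \<le> 2^k * \<bar>\<Delta> k x\<bar>" by simp
      ultimately have "2^k * \<bar>\<Delta> k x\<bar> \<le> 1 + (2^k)\<^sup>2 * (\<Delta> k x)\<^sup>2" by linarith
      then have "(1/2)^k * (2^k * \<bar>\<Delta> k x\<bar>) \<le> (1/2)^k * (1 + (2^k)\<^sup>2 * (\<Delta> k x)\<^sup>2)"
        by (intro mult_left_mono) auto
      then show ?thesis by (simp add: power_divide field_simps power2_eq_square)
    qed
    have "(LINT x|M. \<bar>\<Delta> k x\<bar>) \<le> (LINT x|M. (1/2)^k + 2^k * (\<Delta> k x)\<^sup>2)"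
      using \<Delta>i \<Delta>2 * by (intro integral_mono) auto
    also have "\<dots> = (1/2)^k * measure M (space M) + 2^k * (LINT x|M. (\<Delta> k x)\<^sup>2)"
      using \<Delta>2 by simp
    also have "(LINT x|M. (\<Delta> k x)\<^sup>2) \<le> (1/4)^k"
      unfolding \<Delta>_def using r\<nu>[of k] strict_monoD[OF r, of k "Suc k"] by (intro less_imp_le[OF \<nu>]) auto
    also have "(2::real)^k * (1/4)^k = (1/2)^k" by (simp flip: power_mult_distrib)
    finally show ?thesis by (simp add: distrib_left)
  qed
  have sum\<Delta>: "summable (\<lambda>k. LINT x|M. \<bar>\<Delta> k x\<bar>)"
    by (rule summable_comparison_test'[of "\<lambda>k. (1/2)^k * (measure M (space M) + 1)"])
       (use \<Delta>b in \<open>auto intro!: summable_mult2 summable_geometric\<close>)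
  have "(\<integral>\<^sup>+x. (\<Sum>k. ennreal \<bar>\<Delta> k x\<bar>) \<partial>M) = (\<Sum>k. \<integral>\<^sup>+x. ennreal \<bar>\<Delta> k x\<bar> \<partial>M)"
    by (rule nn_integral_suminf) (simp add: \<Delta>_def)
  also have "\<dots> = (\<Sum>k. ennreal (LINT x|M. \<bar>\<Delta> k x\<bar>))"
  proof (rule suminf_cong)
    show "(\<integral>\<^sup>+x. ennreal \<bar>\<Delta> k x\<bar> \<partial>M) = ennreal (LINT x|M. \<bar>\<Delta> k x\<bar>)" for k
      by (rule nn_integral_eq_integral) (simp_all add: \<Delta>i)
  qed
  also have "\<dots> = ennreal (\<Sum>k. LINT x|M. \<bar>\<Delta> k x\<bar>)"
    by (rule suminf_ennreal2[OF _ sum\<Delta>]) simp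
  also have "\<dots> < \<infinity>" by simp
  finally have "AE x in M. (\<Sum>k. ennreal \<bar>\<Delta> k x\<bar>) \<noteq> \<infinity>"
    by (intro nn_integral_PInf_AE) (auto simp: \<Delta>_def)
  then have AEs: "AE x in M. summable (\<lambda>k. \<bar>\<Delta> k x\<bar>)"
    by eventually_elim (auto intro: summable_suminf_not_top)
  define S where "S x = \<bar>G (r 0) x\<bar> + (\<Sum>k. \<bar>\<Delta> k x\<bar>)" for x
  have Si: "integrable M S" unfolding S_def
    using Gi \<Delta>i AEs sum\<Delta> by (intro Bochner_Integration.integrable_add integrable_suminf) auto
  have tele: "G (r k) x = G (r 0) x + (\<Sum>j<k. \<Delta> j x)" for k x
    by (induction k) (auto simp: \<Delta>_def)
  define g where "g x = G (r 0) x + (\<Sum>k. \<Delta> k x)" for x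
  have "(\<lambda>x. \<Sum>k. \<Delta> k x) \<in> borel_measurable M"
    by (rule borel_measurable_suminf) (rule borel_measurable_integrable[OF \<Delta>i])
  then have gm: "g \<in> borel_measurable M"
    unfolding g_def by (rule borel_measurable_add[OF assms(2)])
  have lim: "AE x in M. (\<lambda>k. G (r k) x) \<longlonglongrightarrow> g x"
    using AEs
  proof eventually_elim
    case (elim x)
    have "(\<lambda>k. G (r 0) x + (\<Sum>j<k. \<Delta> j x)) \<longlonglongrightarrow> g x" unfolding g_def
      by (intro tendsto_add tendsto_const summable_LIMSEQ summable_rabs_cancel[OF elim])
    then show ?case by (simp only: tele[symmetric])
  qed
  have bound: "AE x in M. \<bar>G (r k) x\<bar> \<le> S x" for k
    using AEs
  proof eventually_elim
    case (elim x)
    have "\<bar>\<Sum>j<k. \<Delta> j x\<bar> \<le> (\<Sum>j<k. \<bar>\<Delta> j x\<bar>)" by (rule sum_abs)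
    also have "\<dots> \<le> (\<Sum>j. \<bar>\<Delta> j x\<bar>)" by (rule sum_le_suminf) (use elim in auto)
    finally show ?case using tele[of k x] unfolding S_def by linarith
  qed
  show ?thesis by (rule that[OF r gm Si lim bound])
qed

text \<open>
  This plays the role of weak compactness followed by Mazur's lemma. The conclusion is almost
  everywhere convergence with an integrable majorant because it feeds Fatou's lemma and the
  dominated convergence theorem.
\<close>
lemma Mazur_AE:
  fixes f :: "nat \<Rightarrow> 'a \<Rightarrow> real"
  assumes "finite_measure M" and [measurable]: "\<And>i. f i \<in> borel_measurable M"
    and I: "\<And>i. integrable M (\<lambda>x. (f i x)\<^sup>2)" and C: "\<And>i. (LINT x|M. (f i x)\<^sup>2) \<le> C"
  obtains w N g S where "\<And>k. convex_weights k (N k) (w k)" "g \<in> borel_measurable M" "integrable M S"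
    "AE x in M. (\<lambda>k. \<Sum>i\<le>N k. w k i * f i x) \<longlonglongrightarrow> g x"
    "\<And>k. AE x in M. \<bar>\<Sum>i\<le>N k. w k i * f i x\<bar> \<le> S x"
proof -
  obtain w N where w: "\<And>n. convex_weights n (N n) (w n)" and
    Cauchy: "\<And>r. r > 0 \<Longrightarrow> \<exists>n0. \<forall>n\<ge>n0. \<forall>m\<ge>n0.
       (LINT x|M. ((\<Sum>i\<le>N n. w n i * f i x) - (\<Sum>i\<le>N m. w m i * f i x))\<^sup>2) < r"
    by (rule tail_convex_combinations_Cauchy_L2[of f M C, OF assms(2-4)]) blast
  obtain r g S where rgS: "strict_mono (r :: nat \<Rightarrow> nat)" "g \<in> borel_measurable M" "integrable M S"
    "AE x in M. (\<lambda>k. \<Sum>i\<le>N (r k). w (r k) i * f i x) \<longlonglongrightarrow> g x"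
    "\<And>k. AE x in M. \<bar>\<Sum>i\<le>N (r k). w (r k) i * f i x\<bar> \<le> S x"
  proof (rule Cauchy_L2_AE_subseq[of M "\<lambda>n x. \<Sum>i\<le>N n. w n i * f i x", OF assms(1) _ _ Cauchy])
    show "(\<lambda>x. \<Sum>i\<le>N n. w n i * f i x) \<in> borel_measurable M" for n by measurable
    show "integrable M (\<lambda>x. (\<Sum>i\<le>N n. w n i * f i x)\<^sup>2)" for n
      by (rule square_integrable_lincomb[OF assms(2) I])
  qed auto
  have "convex_weights k (N (r k)) (w (r k))" for k
    by (rule convex_weights_mono[OF w order_refl seq_suble[OF rgS(1)]])
  then show ?thesis by (rule that[OF _ rgS(2-5)])
qed

section \<open>Convexity of the integrand\<close>

text \<open>
  By \<open>2 r q - r\<^sup>2 \<le> q\<^sup>2\<close> and \<open>2 s u - s\<^sup>2 a \<le> u\<^sup>2 / a\<close> with \<open>u = a + q\<^sup>2\<close>. The condition \<open>0 \<le> s\<close> makes the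
  first inequality usable in the second, and it also covers \<open>a = q = 0\<close>, where the left-hand side is
  \<open>- 2 s r\<^sup>2\<close>.
\<close>
lemma affine_minorant_le_quot:
  assumes "0 \<le> a" "0 \<le> s"
  shows "ennreal (2 * s * (a + 2 * r * q - r\<^sup>2) - s\<^sup>2 * a) \<le> quot ((a + q\<^sup>2)\<^sup>2) a"
proof (cases "a = 0")
  case True
  show ?thesis
  proof (cases "q = 0")
    case q: True
    have "- (2 * s * r\<^sup>2) \<le> 0" using assms by simp
    then show ?thesis using True q by (simp add: quot_def ennreal_neg)
  qed (use True in \<open>simp add: quot_def\<close>)
next
  case False
  then have "a > 0" using assms by simp
  have "2 * r * q - r\<^sup>2 \<le> q\<^sup>2" using sum_squares_bound[of r q] by simp
  then have "2 * s * (a + 2 * r * q - r\<^sup>2) \<le> 2 * s * (a + q\<^sup>2)"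
    using assms by (intro mult_left_mono) auto
  moreover have "2 * s * (a + q\<^sup>2) - s\<^sup>2 * a \<le> (a + q\<^sup>2)\<^sup>2 / a"
  proof -
    have "0 \<le> ((a + q\<^sup>2) - s * a)\<^sup>2 / a" using \<open>a > 0\<close> by simp
    also have "\<dots> = (a + q\<^sup>2)\<^sup>2 / a - (2 * s * (a + q\<^sup>2) - s\<^sup>2 * a)"
      using \<open>a > 0\<close> by (simp add: power2_eq_square field_simps)
    finally show ?thesis by simp
  qed
  ultimately show ?thesis using False by (simp add: quot_def ennreal_leI)
qed

text \<open>
  Together with \<open>affine_minorant_le_quot\<close> this says that the integrand is the supremum of its affine
  minorants; both conventions of \<open>quot\<close> at \<open>a = 0\<close> agree with that supremum.
\<close>
lemma quot_le_if_affine_minorants_le: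
  assumes "0 \<le> a" and le: "\<And>s r. 0 \<le> s \<Longrightarrow> ennreal (2 * s * (a + 2 * r * q - r\<^sup>2) - s\<^sup>2 * a) \<le> c"
  shows "quot ((a + q\<^sup>2)\<^sup>2) a \<le> c"
proof -
  consider "a > 0" | "a = 0" "q = 0" | "a = 0" "q \<noteq> 0" using assms(1) by linarith
  then show ?thesis
  proof cases
    case 1
    \<comment> \<open>The supremum is attained at \<open>s = u / a\<close> with \<open>u = a + q\<^sup>2\<close>, and \<open>r = q\<close>.\<close>
    have "2 * ((a + q\<^sup>2) / a) * (a + 2 * q * q - q\<^sup>2) - ((a + q\<^sup>2) / a)\<^sup>2 * a = (a + q\<^sup>2)\<^sup>2 / a"
      using 1 by (simp add: power2_eq_square field_simps)
    then show ?thesis using le[of "(a + q\<^sup>2) / a" q] 1 by (simp add: quot_def)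
  next
    case 2
    then show ?thesis by (simp add: quot_def)
  next
    case 3
    have "c = top"
    proof (rule ccontr)
      assume "c \<noteq> top"
      then obtain b where b: "b \<ge> 0" "c = ennreal b" by (cases c) auto
      \<comment> \<open>For \<open>a = 0\<close> and \<open>r = q\<close> the minorant is \<open>2 s q\<^sup>2\<close>, which is unbounded in \<open>s\<close>.\<close>
      have "2 * ((b + 1) / (2 * q\<^sup>2)) * (a + 2 * q * q - q\<^sup>2) - ((b + 1) / (2 * q\<^sup>2))\<^sup>2 * a = b + 1"
        using 3 by (simp add: power2_eq_square)
      then have "ennreal (b + 1) \<le> c" using le[of "(b + 1) / (2 * q\<^sup>2)" q] b(1) by simp
      then show False using b by (simp add: ennreal_le_iff2)
    qed
    then show ?thesis by simp
  qed
qed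

lemma quot_convex:
  assumes w: "convex_weights k N w" and a: "\<And>i. 0 \<le> a i"
  shows "quot (((\<Sum>i\<le>N. w i * a i) + (\<Sum>i\<le>N. w i * q i)\<^sup>2)\<^sup>2) (\<Sum>i\<le>N. w i * a i)
    \<le> (\<Sum>i\<le>N. ennreal (w i) * quot ((a i + (q i)\<^sup>2)\<^sup>2) (a i))"
proof (rule quot_le_if_affine_minorants_le)
  have w0: "0 \<le> w i" and w1: "(\<Sum>i\<le>N. w i) = 1" for i using w by (auto simp: convex_weights_def)
  show "0 \<le> (\<Sum>i\<le>N. w i * a i)" using w0 a by (intro sum_nonneg) auto
  fix s r :: real assume s: "0 \<le> s"
  define L where "L i = 2 * s * (a i + 2 * r * q i - r\<^sup>2) - (s\<^sup>2) * a i" for i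
  have "(\<Sum>i\<le>N. w i * L i) = (\<Sum>i\<le>N. (2 * s) * (w i * a i) + (4 * s * r) * (w i * q i) - (2 * s * r\<^sup>2) * w i - s\<^sup>2 * (w i * a i))"
    by (intro sum.cong) (auto simp: L_def algebra_simps)
  also have "\<dots> = (2 * s) * (\<Sum>i\<le>N. w i * a i) + (4 * s * r) * (\<Sum>i\<le>N. w i * q i) - (2 * s * r\<^sup>2) * (\<Sum>i\<le>N. w i) - s\<^sup>2 * (\<Sum>i\<le>N. w i * a i)"
    by (simp only: sum.distrib sum_subtractf sum_distrib_left)
  finally have "2 * s * ((\<Sum>i\<le>N. w i * a i) + 2 * r * (\<Sum>i\<le>N. w i * q i) - r\<^sup>2) - s\<^sup>2 * (\<Sum>i\<le>N. w i * a i)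
      = (\<Sum>i\<le>N. w i * L i)" by (simp add: w1 algebra_simps)
  also have "ennreal \<dots> \<le> ennreal (\<Sum>i\<le>N. w i * max 0 (L i))"
    using w0 by (intro ennreal_leI sum_mono mult_left_mono) auto
  also have "\<dots> = (\<Sum>i\<le>N. ennreal (w i) * ennreal (L i))"
  proof -
    have "ennreal (max 0 x) = ennreal x" for x by (auto simp: max_def ennreal_neg)
    then show ?thesis using w0 by (simp add: sum_ennreal[symmetric] ennreal_mult del: sum_ennreal)
  qed
  also have "\<dots> \<le> (\<Sum>i\<le>N. ennreal (w i) * quot ((a i + (q i)\<^sup>2)\<^sup>2) (a i))"
    unfolding L_def by (intro sum_mono mult_left_mono affine_minorant_le_quot a s) auto
  finally show "ennreal (2 * s * ((\<Sum>i\<le>N. w i * a i) + 2 * r * (\<Sum>i\<le>N. w i * q i) - r\<^sup>2) - s\<^sup>2 * (\<Sum>i\<le>N. w i * a i))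
     \<le> (\<Sum>i\<le>N. ennreal (w i) * quot ((a i + (q i)\<^sup>2)\<^sup>2) (a i))" .
qed

lemma quot_lsc:
  assumes "a \<longlonglongrightarrow> a0" "q \<longlonglongrightarrow> q0" and a: "\<And>n. 0 \<le> a n"
  shows "quot ((a0 + q0\<^sup>2)\<^sup>2) a0 \<le> liminf (\<lambda>n. quot ((a n + (q n)\<^sup>2)\<^sup>2) (a n))"
proof (rule quot_le_if_affine_minorants_le)
  show "0 \<le> a0" using assms by (intro LIMSEQ_le_const) auto
  fix s r :: real assume s: "0 \<le> s"
  have "(\<lambda>n. ennreal (2 * s * (a n + 2 * r * q n - r\<^sup>2) - s\<^sup>2 * a n)) \<longlonglongrightarrow> ennreal (2 * s * (a0 + 2 * r * q0 - r\<^sup>2) - s\<^sup>2 * a0)"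
    by (intro tendsto_ennrealI tendsto_intros assms)
  then have "ennreal (2 * s * (a0 + 2 * r * q0 - r\<^sup>2) - s\<^sup>2 * a0) = liminf (\<lambda>n. ennreal (2 * s * (a n + 2 * r * q n - r\<^sup>2) - s\<^sup>2 * a n))"
    by (rule lim_imp_Liminf[symmetric, rotated]) simp
  also have "\<dots> \<le> liminf (\<lambda>n. quot ((a n + (q n)\<^sup>2)\<^sup>2) (a n))"
    by (intro Liminf_mono always_eventually allI affine_minorant_le_quot a s)
  finally show "ennreal (2 * s * (a0 + 2 * r * q0 - r\<^sup>2) - s\<^sup>2 * a0) \<le> liminf (\<lambda>n. quot ((a n + (q n)\<^sup>2)\<^sup>2) (a n))" .
qed

lemma quot_ge_square:
  assumes "0 \<le> a"
  shows "ennreal (q\<^sup>2) \<le> quot ((a + q\<^sup>2)\<^sup>2) a"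
proof -
  have "ennreal (q\<^sup>2) \<le> ennreal (2 * 1 * (a + 2 * q * q - q\<^sup>2) - 1\<^sup>2 * a)"
    using assms by (intro ennreal_leI) (simp add: power2_eq_square)
  also have "\<dots> \<le> quot ((a + q\<^sup>2)\<^sup>2) a" by (rule affine_minorant_le_quot[OF assms]) simp
  finally show ?thesis .
qed

lemma quot_ge_fourth_power:
  assumes "0 \<le> a" "a \<le> K" "0 < K"
  shows "ennreal (q ^ 4 / K) \<le> quot ((a + q\<^sup>2)\<^sup>2) a"
proof -
  \<comment> \<open>Evaluate the minorant at \<open>s = q\<^sup>2 / K\<close> and \<open>r = q\<close>.\<close>
  have "q ^ 4 * a / K\<^sup>2 \<le> q ^ 4 / K"
    using assms by (simp add: power2_eq_square divide_le_eq mult_left_mono)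
  moreover have "0 \<le> 2 * q\<^sup>2 / K * a" using assms by simp
  moreover have "2 * (q\<^sup>2 / K) * (a + 2 * q * q - q\<^sup>2) - (q\<^sup>2 / K)\<^sup>2 * a
     = 2 * q\<^sup>2 / K * a + 2 * (q ^ 4 / K) - q ^ 4 * a / K\<^sup>2"
    by (simp add: power2_eq_square power4_eq_xxxx algebra_simps add_divide_distrib)
  ultimately have "q ^ 4 / K \<le> 2 * (q\<^sup>2 / K) * (a + 2 * q * q - q\<^sup>2) - (q\<^sup>2 / K)\<^sup>2 * a" by linarith
  then have "ennreal (q ^ 4 / K) \<le> ennreal (2 * (q\<^sup>2 / K) * (a + 2 * q * q - q\<^sup>2) - (q\<^sup>2 / K)\<^sup>2 * a)"
    by (rule ennreal_leI)
  also have "\<dots> \<le> quot ((a + q\<^sup>2)\<^sup>2) a" using assms by (intro affine_minorant_le_quot) auto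
  finally show ?thesis .
qed

lemma borel_measurable_quot [measurable]:
  assumes [measurable]: "f \<in> borel_measurable M" "g \<in> borel_measurable M"
  shows "(\<lambda>x. quot (f x) (g x)) \<in> borel_measurable M"
  unfolding quot_def by measurable

section \<open>Continuity of curvature and torsion\<close>

lemma deriv_within_eq:
  fixes f g :: "real \<Rightarrow> 'a::euclidean_space"
  assumes "0 < l" "t \<in> {0..l}" "\<And>s. s \<in> {0..l} \<Longrightarrow> g s = f s"
    "(f has_vector_derivative f') (at t within {0..l})"
  shows "deriv_within l g t = f'"
proof -
  have "(g has_vector_derivative f') (at t within {0..l})"
    using assms by (intro has_vector_derivative_transform[OF assms(2) assms(3) assms(4)]) auto
  from vector_derivative_within_closed_interval[OF assms(1,2) this] show ?thesis
    by (simp add: deriv_within_def)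
qed

lemma has_real_derivative_norm:
  fixes v :: "real \<Rightarrow> 'a::real_inner"
  assumes "(v has_vector_derivative v') (at t within S)" "v t \<noteq> 0"
  shows "((\<lambda>t. norm (v t)) has_real_derivative (v t \<bullet> v') / norm (v t)) (at t within S)"
proof -
  have "((\<lambda>t. norm (v t)) has_derivative (\<lambda>h. (h *\<^sub>R v') \<bullet> sgn (v t))) (at t within S)"
    using has_derivative_compose[OF assms(1)[unfolded has_vector_derivative_def] has_derivative_norm[OF assms(2)]]
    by simp
  then show ?thesis unfolding has_field_derivative_def
    by (rule has_derivative_eq_rhs) (simp add: fun_eq_iff sgn_div_norm inner_commute divide_inverse mult_ac)
qed

text \<open>
  Unfolding the Frenet frame expresses both in terms of the first three derivatives of the curve. The
  positivity of the curvature is what allows the principal normal to be differentiated.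
\<close>
lemma continuous_curvature_torsion:
  assumes l: "0 < l" and C3: "Ck_on 3 {0..l} \<gamma>" and pos: "\<forall>t\<in>{0..l}. curvature l \<gamma> t > 0"
  shows "continuous_on {0..l} (curvature l \<gamma>)" "continuous_on {0..l} (torsion l \<gamma>)"
proof -
  obtain \<gamma>1 \<gamma>2 \<gamma>3 where d:
    "\<And>t. t \<in> {0..l} \<Longrightarrow> (\<gamma> has_vector_derivative \<gamma>1 t) (at t within {0..l})"
    "\<And>t. t \<in> {0..l} \<Longrightarrow> (\<gamma>1 has_vector_derivative \<gamma>2 t) (at t within {0..l})"
    "\<And>t. t \<in> {0..l} \<Longrightarrow> (\<gamma>2 has_vector_derivative \<gamma>3 t) (at t within {0..l})"
    "continuous_on {0..l} \<gamma>3"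
    using C3 unfolding numeral_3_eq_3 Ck_on.simps by metis
  have c: "continuous_on {0..l} \<gamma>1" "continuous_on {0..l} \<gamma>2"
    using d(2,3) has_vector_derivative_continuous unfolding continuous_on_eq_continuous_within by blast+
  have T: "tangent l \<gamma> t = \<gamma>1 t" if "t \<in> {0..l}" for t
    unfolding tangent_def by (rule deriv_within_eq[OF l that refl d(1)[OF that]])
  have T': "deriv_within l (tangent l \<gamma>) t = \<gamma>2 t" if "t \<in> {0..l}" for t
    by (rule deriv_within_eq[OF l that T d(2)[OF that]])
  then have K: "curvature l \<gamma> t = norm (\<gamma>2 t)" if "t \<in> {0..l}" for t
    using that by (simp add: curvature_def)
  then show "continuous_on {0..l} (curvature l \<gamma>)"
    using c(2) by (subst continuous_on_cong[OF refl K]) (auto intro: continuous_intros)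
  have nz: "\<gamma>2 t \<noteq> 0" if "t \<in> {0..l}" for t using pos K that by force
  have N: "principal_normal l \<gamma> t = inverse (norm (\<gamma>2 t)) *\<^sub>R \<gamma>2 t" if "t \<in> {0..l}" for t
    using that by (simp add: principal_normal_def T' K)
  define N' where "N' t = inverse (norm (\<gamma>2 t)) *\<^sub>R \<gamma>3 t +
      (- (inverse (norm (\<gamma>2 t)) * ((\<gamma>2 t \<bullet> \<gamma>3 t) / norm (\<gamma>2 t)) * inverse (norm (\<gamma>2 t)))) *\<^sub>R \<gamma>2 t" for t
  have "((\<lambda>t. inverse (norm (\<gamma>2 t)) *\<^sub>R \<gamma>2 t) has_vector_derivative N' t) (at t within {0..l})"
    if "t \<in> {0..l}" for t
    unfolding N'_def using nz[OF that]
    by (intro has_vector_derivative_scaleR DERIV_inverse' has_real_derivative_norm d(3) that) auto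
  then have NN: "deriv_within l (principal_normal l \<gamma>) t = N' t" if "t \<in> {0..l}" for t
    using that by (intro deriv_within_eq[OF l _ N]) auto
  have "torsion l \<gamma> t = N' t \<bullet> cross3 (\<gamma>1 t) (inverse (norm (\<gamma>2 t)) *\<^sub>R \<gamma>2 t)" if "t \<in> {0..l}" for t
    using that by (simp add: torsion_def NN binormal_def T N)
  moreover have "continuous_on {0..l} (\<lambda>t. N' t \<bullet> cross3 (\<gamma>1 t) (inverse (norm (\<gamma>2 t)) *\<^sub>R \<gamma>2 t))"
    unfolding N'_def using nz c d(4)
    by (intro continuous_intros continuous_on_cross) auto
  ultimately show "continuous_on {0..l} (torsion l \<gamma>)"
    by (subst continuous_on_cong[OF refl]) auto
qed

section \<open>Calculus of weak derivatives\<close>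

lemma integrable_lebesgue_on_subset:
  fixes u :: "real \<Rightarrow> real"
  assumes "integrable (lebesgue_on T) u" "T \<in> sets lebesgue" "S \<in> sets lebesgue" "S \<subseteq> T"
  shows "integrable (lebesgue_on S) u"
proof -
  have "set_integrable lebesgue T u"
    using assms(1) integrable_restrict_space[of T lebesgue u] assms(2) by (simp add: set_integrable_def)
  then have "set_integrable lebesgue S u" by (rule set_integrable_subset[OF _ assms(3,4)])
  then show ?thesis
    using integrable_restrict_space[of S lebesgue u] assms(3) by (simp add: set_integrable_def)
qed

lemma integrable_imp_locally_integrable:
  assumes "integrable (lebesgue_on T) u" "T \<in> sets lebesgue" "{0<..<l} \<subseteq> T"
  shows "locally_integrable l u"
  unfolding locally_integrable_def
  using integrable_lebesgue_on_subset[OF assms(1,2)] assms(3)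
  by (meson dual_order.trans fmeasurableD lmeasurable_compact)

lemma continuous_imp_locally_integrable:
  "continuous_on {0..l} u \<Longrightarrow> locally_integrable l u"
  by (rule integrable_imp_locally_integrable[OF continuous_imp_integrable_real]) auto

lemma test_function_bounded:
  assumes "test_function l \<phi>" "0 < l"
  obtains D where "0 \<le> D" "\<And>t. \<bar>\<phi> t\<bar> \<le> D" "\<And>t. \<bar>deriv \<phi> t\<bar> \<le> D"
proof -
  obtain a b where ab: "0 < a" "a < b" "b < l" "\<And>t. t \<notin> {a..b} \<Longrightarrow> \<phi> t = 0" "\<And>t. t \<notin> {a..b} \<Longrightarrow> deriv \<phi> t = 0"
    by (rule test_function_support[OF assms]) blast
  have "\<exists>B. \<forall>t\<in>{a..b}. \<bar>f t\<bar> \<le> B" if "continuous_on UNIV f" for f :: "real \<Rightarrow> real"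
    using compact_imp_bounded[OF compact_continuous_image[OF continuous_on_subset[OF that, of "{a..b}"]]]
    by (force simp: bounded_iff)
  from this[OF test_function_C1(2)[OF assms(1)]] this[OF test_function_C1(3)[OF assms(1)]]
  obtain B1 B2 where B: "\<And>t. t \<in> {a..b} \<Longrightarrow> \<bar>\<phi> t\<bar> \<le> B1" "\<And>t. t \<in> {a..b} \<Longrightarrow> \<bar>deriv \<phi> t\<bar> \<le> B2" by blast
  show ?thesis
  proof (rule that[of "max 0 (max B1 B2)"])
    show "\<bar>\<phi> t\<bar> \<le> max 0 (max B1 B2)" for t
      using B(1)[of t] ab(4)[of t] by (cases "t \<in> {a..b}") auto
    show "\<bar>deriv \<phi> t\<bar> \<le> max 0 (max B1 B2)" for t
      using B(2)[of t] ab(5)[of t] by (cases "t \<in> {a..b}") auto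
  qed simp
qed

lemma integrable_times_test_function:
  assumes "test_function l \<phi>" "0 < l" "locally_integrable l u"
  shows "integrable (lebesgue_on {0<..<l}) (\<lambda>t. u t * \<phi> t)"
    "integrable (lebesgue_on {0<..<l}) (\<lambda>t. u t * deriv \<phi> t)"
proof -
  obtain a b where ab: "0 < a" "a < b" "b < l" "\<And>t. t \<notin> {a..b} \<Longrightarrow> \<phi> t = 0" "\<And>t. t \<notin> {a..b} \<Longrightarrow> deriv \<phi> t = 0"
    by (rule test_function_support[OF assms(1,2)]) blast
  show "integrable (lebesgue_on {0<..<l}) (\<lambda>t. u t * \<phi> t)"
    by (rule integrable_times_compact_support[OF assms(3) test_function_C1(2)[OF assms(1)] ab(1,3,4)])
  show "integrable (lebesgue_on {0<..<l}) (\<lambda>t. u t * deriv \<phi> t)"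
    by (rule integrable_times_compact_support[OF assms(3) test_function_C1(3)[OF assms(1)] ab(1,3,5)])
qed

lemma locally_integrable_sum:
  assumes "\<And>i. i \<in> I \<Longrightarrow> locally_integrable l (u i)"
  shows "locally_integrable l (\<lambda>t. \<Sum>i\<in>I. w i * u i t)"
  using assms unfolding locally_integrable_def
  by (auto intro!: Bochner_Integration.integrable_sum integrable_mult_right)

lemma has_weak_deriv_lincomb:
  assumes l: "0 < l" and "\<And>i. i \<in> I \<Longrightarrow> has_weak_deriv l (u i) (g i)"
  shows "has_weak_deriv l (\<lambda>t. \<Sum>i\<in>I. w i * u i t) (\<lambda>t. \<Sum>i\<in>I. w i * g i t)"
proof -
  have li: "locally_integrable l (u i)" "locally_integrable l (g i)" if "i \<in> I" for i
    using assms(2)[OF that] by (auto simp: has_weak_deriv_def)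
  have "(LINT t|lebesgue_on {0<..<l}. (\<Sum>i\<in>I. w i * u i t) * deriv \<phi> t) =
        - (LINT t|lebesgue_on {0<..<l}. (\<Sum>i\<in>I. w i * g i t) * \<phi> t)" if \<phi>: "test_function l \<phi>" for \<phi>
  proof -
    have "(LINT t|lebesgue_on {0<..<l}. (\<Sum>i\<in>I. w i * u i t) * deriv \<phi> t)
       = (LINT t|lebesgue_on {0<..<l}. (\<Sum>i\<in>I. w i * (u i t * deriv \<phi> t)))"
      by (simp add: sum_distrib_right mult.assoc)
    also have "\<dots> = (\<Sum>i\<in>I. LINT t|lebesgue_on {0<..<l}. w i * (u i t * deriv \<phi> t))"
      by (intro Bochner_Integration.integral_sum integrable_mult_right integrable_times_test_function \<phi> l li)
    also have "\<dots> = (\<Sum>i\<in>I. - (LINT t|lebesgue_on {0<..<l}. w i * (g i t * \<phi> t)))"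
      using assms(2) \<phi> by (intro sum.cong) (auto simp: has_weak_deriv_def)
    also have "\<dots> = - (\<Sum>i\<in>I. LINT t|lebesgue_on {0<..<l}. w i * (g i t * \<phi> t))"
      by (simp add: sum_negf)
    also have "(\<Sum>i\<in>I. LINT t|lebesgue_on {0<..<l}. w i * (g i t * \<phi> t)) =
       (LINT t|lebesgue_on {0<..<l}. (\<Sum>i\<in>I. w i * (g i t * \<phi> t)))"
      by (intro Bochner_Integration.integral_sum[symmetric] integrable_mult_right integrable_times_test_function \<phi> l li)
    also have "\<dots> = (LINT t|lebesgue_on {0<..<l}. (\<Sum>i\<in>I. w i * g i t) * \<phi> t)"
      by (simp add: sum_distrib_right mult.assoc)
    finally show ?thesis .
  qed
  then show ?thesis unfolding has_weak_deriv_def by (intro conjI allI impI locally_integrable_sum li)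
qed

lemma has_weak_deriv_affine:
  assumes l: "0 < l"
  shows "has_weak_deriv l (\<lambda>t. p + q * t) (\<lambda>_. q)"
proof -
  have li: "locally_integrable l (\<lambda>t. p + q * t)" "locally_integrable l (\<lambda>_. q)"
    by (intro continuous_imp_locally_integrable continuous_intros)+
  have "(LINT t|lebesgue_on {0<..<l}. (p + q * t) * deriv \<phi> t) = - (LINT t|lebesgue_on {0<..<l}. q * \<phi> t)"
    if \<phi>: "test_function l \<phi>" for \<phi>
  proof -
    obtain a b where ab: "0 < a" "a < b" "b < l" "\<And>t. t \<notin> {a..b} \<Longrightarrow> \<phi> t = 0" "\<And>t. t \<notin> {a..b} \<Longrightarrow> deriv \<phi> t = 0"
      by (rule test_function_support[OF \<phi> l]) blast
    have "((\<lambda>t. (p + q * t) * deriv \<phi> t + q * \<phi> t) has_integral ((p + q * l) * \<phi> l - (p + q * 0) * \<phi> 0)) {0..l}"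
    proof (rule fundamental_theorem_of_calculus)
      fix t
      have "((\<lambda>t. p + q * t) has_real_derivative q) (at t)" by (auto intro!: derivative_eq_intros)
      from DERIV_mult[OF this test_function_C1(1)[OF \<phi>]]
      show "((\<lambda>t. (p + q * t) * \<phi> t) has_vector_derivative (p + q * t) * deriv \<phi> t + q * \<phi> t) (at t within {0..l})"
        by (simp add: has_real_derivative_iff_has_vector_derivative has_vector_derivative_at_within algebra_simps)
    qed (use l in simp)
    moreover have "\<phi> l = 0" "\<phi> 0 = 0" using ab by auto
    ultimately have "((\<lambda>t. (p + q * t) * deriv \<phi> t + q * \<phi> t) has_integral 0) {0<..<l}"
      by (simp add: has_integral_Icc_iff_Ioo)
    moreover note int = integrable_times_test_function(2)[OF \<phi> l li(1)] integrable_times_test_function(1)[OF \<phi> l li(2)]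
    ultimately have "(LINT t|lebesgue_on {0<..<l}. (p + q * t) * deriv \<phi> t + q * \<phi> t) = 0"
      using has_integral_unique[OF has_integral_integral_lebesgue_on[OF Bochner_Integration.integrable_add[OF int]]] by simp
    then show ?thesis using Bochner_Integration.integral_add[OF int] by linarith
  qed
  then show ?thesis using li by (simp add: has_weak_deriv_def)
qed

lemma has_weak_deriv_add_const:
  assumes l: "0 < l" and u: "has_weak_deriv l u g"
  shows "has_weak_deriv l (\<lambda>t. u t + c) g"
  using has_weak_deriv_lincomb[OF l, of "{True, False}" "\<lambda>b. if b then u else (\<lambda>t. c + 0 * t)" "\<lambda>b. if b then g else (\<lambda>_. 0)" "\<lambda>_. 1"]
    u has_weak_deriv_affine[OF l, of c 0] by simp

text \<open>
  Both sides of the defining identity pass to the limit by dominated convergence, because a test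
  function and its derivative are bounded.
\<close>
lemma has_weak_deriv_limit:
  assumes l: "0 < l" and w: "\<And>k. has_weak_deriv l (U k) (G k)"
    and meas: "\<And>k. U k \<in> borel_measurable (lebesgue_on {0<..<l})" "u \<in> borel_measurable (lebesgue_on {0<..<l})"
      "\<And>k. G k \<in> borel_measurable (lebesgue_on {0<..<l})" "g \<in> borel_measurable (lebesgue_on {0<..<l})"
    and U: "\<And>t. t \<in> {0<..<l} \<Longrightarrow> (\<lambda>k. U k t) \<longlonglongrightarrow> u t" "\<And>k t. t \<in> {0<..<l} \<Longrightarrow> \<bar>U k t\<bar> \<le> B"
    and G: "AE t in lebesgue_on {0<..<l}. (\<lambda>k. G k t) \<longlonglongrightarrow> g t" "\<And>k. AE t in lebesgue_on {0<..<l}. \<bar>G k t\<bar> \<le> S t"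
    and S: "integrable (lebesgue_on {0<..<l}) S"
  shows "has_weak_deriv l u g"
proof -
  let ?M = "lebesgue_on {0<..<l}"
  interpret finite_measure ?M by (rule finite_measure_lebesgue_on) simp
  have "integrable ?M g"
    by (rule integrable_dominated_convergence[OF meas(4,3) S G(1)]) (use G(2) in simp)
  moreover have "integrable ?M u"
    by (rule integrable_dominated_convergence[OF meas(2,1), of "\<lambda>_. B"]) (auto intro!: AE_I2 U)
  moreover have "(LINT t|?M. u t * deriv \<phi> t) = - (LINT t|?M. g t * \<phi> t)" if \<phi>: "test_function l \<phi>" for \<phi>
  proof -
    obtain D where D: "0 \<le> D" "\<And>t. \<bar>\<phi> t\<bar> \<le> D" "\<And>t. \<bar>deriv \<phi> t\<bar> \<le> D"
      by (rule test_function_bounded[OF \<phi> l]) blast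
    have [measurable]: "\<phi> \<in> borel_measurable ?M" "deriv \<phi> \<in> borel_measurable ?M"
      by (intro continuous_imp_measurable_on_sets_lebesgue continuous_on_subset[OF test_function_C1(2)[OF \<phi>]]
          continuous_on_subset[OF test_function_C1(3)[OF \<phi>]]; simp)+
    note [measurable] = meas
    have 1: "(\<lambda>k. LINT t|?M. U k t * deriv \<phi> t) \<longlonglongrightarrow> (LINT t|?M. u t * deriv \<phi> t)"
    proof (rule integral_dominated_convergence[where w = "\<lambda>_. B * D"])
      show "AE t in ?M. (\<lambda>k. U k t * deriv \<phi> t) \<longlonglongrightarrow> u t * deriv \<phi> t"
        by (intro AE_I2 tendsto_intros U(1)) simp
      show "AE t in ?M. norm (U k t * deriv \<phi> t) \<le> B * D" for k
      proof (rule AE_I2)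
        fix t assume "t \<in> space ?M"
        then have "\<bar>U k t\<bar> \<le> B" using U(2) by simp
        with D(3)[of t] show "norm (U k t * deriv \<phi> t) \<le> B * D"
          unfolding real_norm_def abs_mult by (intro mult_mono) auto
      qed
    qed auto
    have 2: "(\<lambda>k. LINT t|?M. G k t * \<phi> t) \<longlonglongrightarrow> (LINT t|?M. g t * \<phi> t)"
    proof (rule integral_dominated_convergence[where w = "\<lambda>t. S t * D"])
      show "AE t in ?M. (\<lambda>k. G k t * \<phi> t) \<longlonglongrightarrow> g t * \<phi> t"
        using G(1) by eventually_elim (intro tendsto_intros)
      show "AE t in ?M. norm (G k t * \<phi> t) \<le> S t * D" for k
        using G(2)[of k]
      proof eventually_elim
        case (elim t)
        with D(2)[of t] show ?case unfolding real_norm_def abs_mult by (intro mult_mono) auto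
      qed
    qed (use S in auto)
    have "(LINT t|?M. U k t * deriv \<phi> t) = - (LINT t|?M. G k t * \<phi> t)" for k
      using w[of k] \<phi> by (simp add: has_weak_deriv_def)
    with tendsto_minus[OF 2] 1 show ?thesis using LIMSEQ_unique by fastforce
  qed
  ultimately show ?thesis by (simp add: has_weak_deriv_def integrable_imp_locally_integrable)
qed

text \<open>
  From \<open>weak_deriv_FTC\<close> and \<open>\<bar>g\<bar> \<le> e g\<^sup>2 + 1/e\<close>. The parameter \<open>e\<close> stays free: choosing
  it small first, and then \<open>\<bar>x - y\<bar>\<close> small, gives equicontinuity of families bounded in \<open>L\<^sup>2\<close>. The end points are reached
  by continuity, as \<open>weak_deriv_FTC\<close> concerns interior points.
\<close>
lemma weak_deriv_modulus_of_continuity: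
  assumes w: "has_weak_deriv l u g" and u: "continuous_on {0..l} u"
    and g: "integrable (lebesgue_on {0<..<l}) (\<lambda>t. (g t)\<^sup>2)" "(LINT t|lebesgue_on {0<..<l}. (g t)\<^sup>2) \<le> C"
    and xy: "x \<in> {0..l}" "y \<in> {0..l}" and e: "0 < e"
  shows "\<bar>u x - u y\<bar> \<le> e * C + \<bar>x - y\<bar> / e"
proof -
  have C: "0 \<le> C" by (rule order_trans[OF _ g(2)]) simp
  have interior: "\<bar>u b - u a\<bar> \<le> e * C + (b - a) / e" if ab: "0 < a" "a < b" "b < l" for a b
  proof -
    have gi: "integrable (lebesgue_on {a..b}) g"
      using w ab by (auto simp: has_weak_deriv_def intro: locally_integrable_interval)
    have g2: "integrable (lebesgue_on {a..b}) (\<lambda>t. (g t)\<^sup>2)"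
      using integrable_imp_locally_integrable[OF g(1), of l] ab by (auto intro: locally_integrable_interval)
    have c: "integrable (lebesgue_on {a..b}) (\<lambda>t. c)" for c :: real
      by (intro finite_measure.integrable_const finite_measure_lebesgue_on) simp
    have "\<bar>u b - u a\<bar> = \<bar>LINT t|lebesgue_on {a..b}. g t\<bar>"
      using weak_deriv_FTC[OF w u ab] by simp
    also have "\<dots> \<le> (LINT t|lebesgue_on {a..b}. e * (g t)\<^sup>2 + 1 / e)"
    proof -
      have "norm (LINT t|lebesgue_on {a..b}. g t) \<le> (LINT t|lebesgue_on {a..b}. e * (g t)\<^sup>2 + 1 / e)"
      proof (rule Bochner_Integration.integral_norm_bound_integral[OF gi])
        fix t
        have "0 \<le> (e * \<bar>g t\<bar> - 1)\<^sup>2" by simp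
        then have "2 * (e * \<bar>g t\<bar>) \<le> e * (e * (g t)\<^sup>2) + 1"
          by (simp add: power2_diff power_mult_distrib) (simp add: power2_eq_square mult.assoc)
        moreover have "0 \<le> e * \<bar>g t\<bar>" using e by simp
        ultimately have "e * \<bar>g t\<bar> \<le> e * (e * (g t)\<^sup>2) + 1" by linarith
        also have "\<dots> = e * (e * (g t)\<^sup>2 + 1 / e)" using e by (simp add: distrib_left)
        finally have "e * \<bar>g t\<bar> \<le> e * (e * (g t)\<^sup>2 + 1 / e)" .
        then show "norm (g t) \<le> e * (g t)\<^sup>2 + 1 / e" using mult_le_cancel_left_pos[OF e] by simp
      qed (use g2 c in auto)
      then show ?thesis by simp
    qed
    also have "\<dots> = e * (LINT t|lebesgue_on {a..b}. (g t)\<^sup>2) + (b - a) / e"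
      using g2 c ab by (simp add: measure_restrict_space)
    finally have 1: "\<bar>u b - u a\<bar> \<le> e * (LINT t|lebesgue_on {a..b}. (g t)\<^sup>2) + (b - a) / e" .
    have "(LINT t|lebesgue_on {a..b}. (g t)\<^sup>2) \<le> (LINT t|lebesgue_on {0<..<l}. (g t)\<^sup>2)"
      by (rule integral_mono_lebesgue_on_AE[OF g(1)]) (use ab in auto)
    then have "(LINT t|lebesgue_on {a..b}. (g t)\<^sup>2) \<le> C" using g(2) by linarith
    with 1 e show ?thesis using mult_left_mono[of "LINT t|lebesgue_on {a..b}. (g t)\<^sup>2" C e] by linarith
  qed
  have ordered: "\<bar>u b - u a\<bar> \<le> e * C + (b - a) / e" if ab: "0 \<le> a" "a < b" "b \<le> l" for a b
  proof -
    define s where "s n = (b - a) / 3 * inverse (real (Suc n))" for n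
    have s0: "s \<longlonglongrightarrow> 0"
      unfolding s_def using tendsto_mult_right_zero[OF LIMSEQ_inverse_real_of_nat] by simp
    have s: "0 < s n" "s n \<le> (b - a) / 3" for n
    proof -
      show "0 < s n" using ab by (simp add: s_def)
      show "s n \<le> (b - a) / 3" using ab unfolding s_def
        by (intro mult_left_le) (auto simp: inverse_le_1_iff)
    qed
    have sl: "0 \<le> b - s n \<and> b - s n \<le> l \<and> 0 \<le> a + s n \<and> a + s n \<le> l" for n
      using s[of n] ab by (auto simp: field_simps)
    have lim: "(\<lambda>n. \<bar>u (b - s n) - u (a + s n)\<bar>) \<longlonglongrightarrow> \<bar>u b - u a\<bar>"
    proof (intro tendsto_intros continuous_on_tendsto_compose[OF u])
      show "(\<lambda>n. b - s n) \<longlonglongrightarrow> b" using tendsto_diff[OF tendsto_const s0, of b] by simp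
      show "(\<lambda>n. a + s n) \<longlonglongrightarrow> a" using tendsto_add[OF tendsto_const s0, of a] by simp
      show "\<forall>\<^sub>F n in sequentially. b - s n \<in> {0..l}" "\<forall>\<^sub>F n in sequentially. a + s n \<in> {0..l}"
        by (rule always_eventually, rule allI, use sl in simp)+
    qed (use ab in auto)
    have "\<bar>u (b - s n) - u (a + s n)\<bar> \<le> e * C + (b - a) / e" for n
    proof -
      have "\<bar>u (b - s n) - u (a + s n)\<bar> \<le> e * C + ((b - s n) - (a + s n)) / e"
        using s[of n] ab by (intro interior) auto
      moreover have "((b - s n) - (a + s n)) / e \<le> (b - a) / e"
        using s[of n] e by (intro divide_right_mono) auto
      ultimately show ?thesis by linarith
    qed
    then show ?thesis by (intro LIMSEQ_le_const2[OF lim]) auto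
  qed
  consider "x < y" | "x = y" | "y < x" by linarith
  then show ?thesis
  proof cases
    case 1
    then show ?thesis using ordered[of x y] xy by (simp add: abs_minus_commute)
  next
    case 2
    then show ?thesis using C e by simp
  next
    case 3
    then show ?thesis using ordered[of y x] xy by simp
  qed
qed

section \<open>The direct method\<close>

text \<open>
  The energy is defined through an arbitrary choice of the weak derivative; by uniqueness any other one
  gives the same value.
\<close>
lemma energy_eq:
  assumes "continuous_on {0..l} \<theta>" "has_weak_deriv l \<theta> g"
  shows "energy l \<gamma> \<theta> = (\<integral>\<^sup>+ t. quot (((curvature l \<gamma> t)\<^sup>2 * (cos (\<theta> t))\<^sup>2 + (g t + torsion l \<gamma> t)\<^sup>2)\<^sup>2)
      ((curvature l \<gamma> t)\<^sup>2 * (cos (\<theta> t))\<^sup>2) \<partial>lebesgue_on {0<..<l})"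
proof -
  have "has_weak_deriv l \<theta> (weak_deriv l \<theta>)"
    unfolding weak_deriv_def by (rule someI[of "has_weak_deriv l \<theta>" g]) (rule assms(2))
  from weak_deriv_unique[OF this assms(2,1)] show ?thesis
    unfolding energy_def by (intro nn_integral_cong_AE) (auto elim!: eventually_mono)
qed

lemma continuous_imp_L4:
  assumes "continuous_on {0..l} \<theta>"
  shows "\<theta> \<in> L4 l"
proof -
  have "continuous_on {0..l} (\<lambda>t. \<bar>\<theta> t\<bar> ^ 4)" by (intro continuous_intros assms)
  then have "integrable (lebesgue_on {0<..<l}) (\<lambda>t. \<bar>\<theta> t\<bar> ^ 4)"
    by (intro integrable_lebesgue_on_subset[OF continuous_imp_integrable_real]) auto
  moreover have "\<theta> \<in> borel_measurable (lebesgue_on {0<..<l})"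
    by (intro continuous_imp_measurable_on_sets_lebesgue continuous_on_subset[OF assms]) auto
  ultimately show ?thesis by (simp add: L4_def)
qed

lemma W14_I:
  assumes "continuous_on {0..l} \<theta>" "has_weak_deriv l \<theta> g" "g \<in> L4 l"
  shows "\<theta> \<in> W14 l"
  using assms continuous_imp_L4 by (auto simp: W14_def)

lemma energy_add_multiple_pi:
  assumes "0 < l" "\<theta> \<in> W14 l"
  shows "(\<lambda>t. \<theta> t + of_int k * pi) \<in> W14 l" "energy l \<gamma> (\<lambda>t. \<theta> t + of_int k * pi) = energy l \<gamma> \<theta>"
proof -
  let ?\<theta> = "\<lambda>t. \<theta> t + of_int k * pi"
  obtain g where g: "continuous_on {0..l} \<theta>" "g \<in> L4 l" "has_weak_deriv l \<theta> g"
    using assms by (auto simp: W14_def)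
  have c: "continuous_on {0..l} ?\<theta>" by (intro continuous_intros g)
  have w: "has_weak_deriv l ?\<theta> g" by (rule has_weak_deriv_add_const[OF assms(1) g(3)])
  show "?\<theta> \<in> W14 l" by (rule W14_I[OF c w g(2)])
  have s: "sin (of_int k * pi) = 0" using sin_zero_iff_int2 by blast
  then have "(cos (of_int k * pi))\<^sup>2 = 1" by (simp add: cos_squared_eq)
  then have "(cos (?\<theta> t))\<^sup>2 = (cos (\<theta> t))\<^sup>2" for t
    by (simp add: cos_add s power_mult_distrib)
  then show "energy l \<gamma> ?\<theta> = energy l \<gamma> \<theta>"
    unfolding energy_eq[OF c w] energy_eq[OF g(1,3)] by simp
qed

lemma integrable_nn_integral_le:
  assumes "f \<in> borel_measurable M" "\<And>x. 0 \<le> f x" "(\<integral>\<^sup>+x. ennreal (f x) \<partial>M) \<le> ennreal C" "0 \<le> C"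
  shows "integrable M f" "(LINT x|M. f x) \<le> C"
proof -
  have "(\<integral>\<^sup>+x. ennreal (norm (f x)) \<partial>M) < \<infinity>"
    using assms(2,3) by (simp add: order_le_less_trans[OF assms(3)])
  then show i: "integrable M f" by (rule integrableI_bounded[OF assms(1)])
  then show "(LINT x|M. f x) \<le> C"
    using assms(2-4) nn_integral_eq_integral[OF i] by simp
qed

text \<open>
  Compactness and lower semicontinuity in one step. The limit \<open>\<theta>\<close> comes from Arzela-Ascoli, its weak
  derivative from \<open>Mazur_AE\<close>. The integrand is evaluated at the same convex combinations of both of
  its arguments: there \<open>quot_lsc\<close> and Fatou's lemma bound the energy of \<open>\<theta>\<close> from above, and
  \<open>quot_convex\<close> returns to convex combinations of the energies of the sequence.
\<close>
lemma energy_sequentially_compact: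
  assumes l: "0 < l" and cont: "continuous_on {0..l} (curvature l \<gamma>)" "continuous_on {0..l} (torsion l \<gamma>)"
    and W: "\<And>n. \<Theta> n \<in> W14 l" and E: "\<And>n. energy l \<gamma> (\<Theta> n) = ennreal (E n)" "\<And>n. 0 \<le> E n" "E \<longlonglongrightarrow> m"
    and R: "\<And>n. \<bar>\<Theta> n 0\<bar> \<le> R"
  obtains \<theta> r where "\<theta> \<in> W14 l" "strict_mono r" "\<And>t. t \<in> {0..l} \<Longrightarrow> (\<lambda>n. \<Theta> (r n) t) \<longlonglongrightarrow> \<theta> t"
    "energy l \<gamma> \<theta> \<le> ennreal m"
proof -
  let ?M = "lebesgue_on {0<..<l}"
  interpret finite_measure ?M by (rule finite_measure_lebesgue_on) simp
  have mc: "f \<in> borel_measurable ?M" if "continuous_on {0..l} f" for f :: "real \<Rightarrow> real"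
    by (intro continuous_imp_measurable_on_sets_lebesgue continuous_on_subset[OF that]) auto
  have bdd: "\<exists>B>0. \<forall>t\<in>{0..l}. \<bar>f t\<bar> \<le> B" if "continuous_on {0..l} f" for f :: "real \<Rightarrow> real"
  proof -
    have "bounded (f ` {0..l})" by (rule compact_imp_bounded[OF compact_continuous_image[OF that]]) simp
    then obtain B where "\<forall>t\<in>{0..l}. \<bar>f t\<bar> \<le> B" by (force simp: bounded_iff)
    \<comment> \<open>A positive bound is chosen because the bound for the curvature is divided by below.\<close>
    then show ?thesis by (intro exI[of _ "max 1 B"]) (auto simp: le_max_iff_disj)
  qed
  define \<tau> where "\<tau> = torsion l \<gamma>"
  define \<alpha> where "\<alpha> u t = (curvature l \<gamma> t)\<^sup>2 * (cos (u t))\<^sup>2" for u t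
  have \<alpha>0: "0 \<le> \<alpha> u t" for u t by (simp add: \<alpha>_def)
  have \<alpha>c: "continuous_on {0..l} (\<alpha> u)" if "continuous_on {0..l} u" for u
    unfolding \<alpha>_def by (intro continuous_intros cont that)
  obtain K where K: "0 < K" "\<And>t. t \<in> {0..l} \<Longrightarrow> \<bar>(curvature l \<gamma> t)\<^sup>2\<bar> \<le> K"
    using bdd[OF continuous_on_power[OF cont(1)], of 2] by blast
  have \<alpha>K: "\<alpha> u t \<le> K" if "t \<in> {0..l}" for u t
  proof -
    have "\<alpha> u t \<le> (curvature l \<gamma> t)\<^sup>2 * 1"
      unfolding \<alpha>_def by (intro mult_left_mono) (auto simp: cos_squared_eq)
    with K(2)[OF that] show ?thesis by simp
  qed
  obtain B where B: "0 < B" "\<And>t. t \<in> {0..l} \<Longrightarrow> \<bar>\<tau> t\<bar> \<le> B" using bdd[OF cont(2)] by (auto simp: \<tau>_def)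
  have [measurable]: "\<tau> \<in> borel_measurable ?M" unfolding \<tau>_def by (rule mc[OF cont(2)])
  have energy: "energy l \<gamma> u = (\<integral>\<^sup>+t. quot ((\<alpha> u t + (v t + \<tau> t)\<^sup>2)\<^sup>2) (\<alpha> u t) \<partial>?M)"
    if "continuous_on {0..l} u" "has_weak_deriv l u v" for u v
    using energy_eq[OF that] by (simp add: \<alpha>_def \<tau>_def)
  obtain g where g: "\<And>n. g n \<in> L4 l" "\<And>n. has_weak_deriv l (\<Theta> n) (g n)"
    using W unfolding W14_def by (simp add: Bex_def) metis
  have \<Theta>c: "continuous_on {0..l} (\<Theta> n)" for n using W[of n] by (simp add: W14_def)
  have gm [measurable]: "g n \<in> borel_measurable ?M" for n using g(1)[of n] by (simp add: L4_def)
  obtain C where C: "\<And>n. E n \<le> C"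
    using Bseq_bdd_above[OF convergent_imp_Bseq[OF convergentI[OF E(3)]]] by (auto simp: bdd_above_def)
  have C0: "0 \<le> C" using C[of 0] E(2)[of 0] by linarith

  define C2 where "C2 = 2 * C + 2 * B\<^sup>2 * measure ?M (space ?M)"
  have L2: "integrable ?M (\<lambda>t. (g n t)\<^sup>2)" "(LINT t|?M. (g n t)\<^sup>2) \<le> C2" for n
  proof -
    have "(\<integral>\<^sup>+t. ennreal ((g n t + \<tau> t)\<^sup>2) \<partial>?M) \<le> energy l \<gamma> (\<Theta> n)"
      unfolding energy[OF \<Theta>c g(2)] by (intro nn_integral_mono quot_ge_square \<alpha>0)
    also have "\<dots> \<le> ennreal C" unfolding E(1) by (rule ennreal_leI[OF C])
    finally have q: "integrable ?M (\<lambda>t. (g n t + \<tau> t)\<^sup>2)" "(LINT t|?M. (g n t + \<tau> t)\<^sup>2) \<le> C"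
      using integrable_nn_integral_le[of "\<lambda>t. (g n t + \<tau> t)\<^sup>2" ?M C] C0 by auto
    have le: "(g n t)\<^sup>2 \<le> 2 * (g n t + \<tau> t)\<^sup>2 + 2 * B\<^sup>2" if "t \<in> {0<..<l}" for t
    proof -
      have "(\<tau> t)\<^sup>2 \<le> B\<^sup>2" using B(2)[of t] that by (intro abs_le_square_iff[THEN iffD1]) auto
      moreover have "0 \<le> (g n t + 2 * \<tau> t)\<^sup>2" by simp
      ultimately show ?thesis by (simp add: power2_eq_square algebra_simps)
    qed
    have i: "integrable ?M (\<lambda>t. 2 * (g n t + \<tau> t)\<^sup>2 + 2 * B\<^sup>2)" using q(1) by simp
    show i2: "integrable ?M (\<lambda>t. (g n t)\<^sup>2)"
    proof (rule Bochner_Integration.integrable_bound[OF i])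
      show "AE t in ?M. norm ((g n t)\<^sup>2) \<le> norm (2 * (g n t + \<tau> t)\<^sup>2 + 2 * B\<^sup>2)"
        using le by (intro AE_I2) (simp add: abs_of_nonneg)
    qed measurable
    have "(LINT t|?M. (g n t)\<^sup>2) \<le> (LINT t|?M. 2 * (g n t + \<tau> t)\<^sup>2 + 2 * B\<^sup>2)"
      using le by (intro integral_mono[OF i2 i]) simp
    also have "\<dots> \<le> C2" using q by (simp add: C2_def)
    finally show "(LINT t|?M. (g n t)\<^sup>2) \<le> C2" .
  qed
  have C20: "0 \<le> C2" using C0 by (simp add: C2_def)
  have modulus: "\<bar>\<Theta> n x - \<Theta> n y\<bar> \<le> e * C2 + \<bar>x - y\<bar> / e" if "x \<in> {0..l}" "y \<in> {0..l}" "0 < e" for n x y e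
    by (rule weak_deriv_modulus_of_continuity[OF g(2) \<Theta>c L2 that])

  define B\<theta> where "B\<theta> = R + C2 + l"
  have \<Theta>B: "\<bar>\<Theta> n t\<bar> \<le> B\<theta>" if "t \<in> {0..l}" for n t
  proof -
    have "\<bar>\<Theta> n t\<bar> \<le> \<bar>\<Theta> n t - \<Theta> n 0\<bar> + \<bar>\<Theta> n 0\<bar>" by simp
    also have "\<dots> \<le> (C2 + t) + R" using modulus[of t 0 1 n] that R[of n] l by (intro add_mono) auto
    also have "\<dots> \<le> B\<theta>" using that by (simp add: B\<theta>_def)
    finally show ?thesis .
  qed
  obtain \<theta> r where \<theta>: "continuous_on {0..l} \<theta>" "strict_mono (r :: nat \<Rightarrow> nat)"
    "\<And>e. 0 < e \<Longrightarrow> \<exists>N. \<forall>n x. n \<ge> N \<and> x \<in> {0..l} \<longrightarrow> norm (\<Theta> (r n) x - \<theta> x) < e"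
  proof (rule Arzela_Ascoli[of "{0..l}" \<Theta> B\<theta>])
    show "\<exists>d>0. \<forall>n y. y \<in> {0..l} \<and> norm (x - y) < d \<longrightarrow> norm (\<Theta> n x - \<Theta> n y) < e"
      if x: "x \<in> {0..l}" and e: "0 < e" for x e
    proof -
      \<comment> \<open>the parameter of the modulus of continuity that makes its first term at most \<open>e / 2\<close>\<close>
      define s where "s = e / (2 * (C2 + 1))"
      have s: "0 < s" using e C20 by (simp add: s_def)
      have "s * C2 \<le> s * (C2 + 1)" using s by simp
      also have "\<dots> = e / 2" using C20 by (simp add: s_def field_simps)
      finally have sC: "s * C2 \<le> e / 2" .
      have "norm (\<Theta> n x - \<Theta> n y) < e" if y: "y \<in> {0..l}" "norm (x - y) < s * e / 2" for n y
      proof -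
        have "\<bar>x - y\<bar> / s < (s * e / 2) / s" using y(2) s by (intro divide_strict_right_mono) auto
        also have "\<dots> = e / 2" using s by simp
        finally have "\<bar>x - y\<bar> / s < e / 2" .
        with modulus[OF x y(1) s, of n] sC show ?thesis unfolding real_norm_def by argo
      qed
      moreover have "0 < s * e / 2" using s e by simp
      ultimately show ?thesis by blast
    qed
  qed (use \<Theta>B in auto)
  have conv: "(\<lambda>n. \<Theta> (r n) t) \<longlonglongrightarrow> \<theta> t" if "t \<in> {0..l}" for t
    unfolding LIMSEQ_iff using \<theta>(3) that by blast

  obtain w N h S where w: "\<And>k. convex_weights k (N k) (w k)" and h [measurable]: "h \<in> borel_measurable ?M"
    and S: "integrable ?M S" and hlim: "AE t in ?M. (\<lambda>k. \<Sum>i\<le>N k. w k i * g (r i) t) \<longlonglongrightarrow> h t"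
    and hS: "\<And>k. AE t in ?M. \<bar>\<Sum>i\<le>N k. w k i * g (r i) t\<bar> \<le> S t"
    by (rule Mazur_AE[of ?M "\<lambda>i. g (r i)" C2, OF finite_measure_axioms gm L2]) blast
  have w0: "0 \<le> w k i" and w1: "(\<Sum>i\<le>N k. w k i) = 1" for k i using w[of k] by (auto simp: convex_weights_def)
  have wd: "has_weak_deriv l \<theta> h"
  proof (rule has_weak_deriv_limit[OF l, of "\<lambda>k t. \<Sum>i\<le>N k. w k i * \<Theta> (r i) t" "\<lambda>k t. \<Sum>i\<le>N k. w k i * g (r i) t" \<theta> h B\<theta> S])
    show "has_weak_deriv l (\<lambda>t. \<Sum>i\<le>N k. w k i * \<Theta> (r i) t) (\<lambda>t. \<Sum>i\<le>N k. w k i * g (r i) t)" for k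
      by (rule has_weak_deriv_lincomb[OF l g(2)])
    show "(\<lambda>t. \<Sum>i\<le>N k. w k i * \<Theta> (r i) t) \<in> borel_measurable ?M" for k
      by (intro mc continuous_intros \<Theta>c)
    show "(\<lambda>k. \<Sum>i\<le>N k. w k i * \<Theta> (r i) t) \<longlonglongrightarrow> \<theta> t" if "t \<in> {0<..<l}" for t
      by (rule convex_weights_tendsto[OF conv w]) (use that in auto)
    show "\<bar>\<Sum>i\<le>N k. w k i * \<Theta> (r i) t\<bar> \<le> B\<theta>" if "t \<in> {0<..<l}" for k t
    proof -
      have "\<bar>\<Sum>i\<le>N k. w k i * \<Theta> (r i) t\<bar> \<le> (\<Sum>i\<le>N k. \<bar>w k i * \<Theta> (r i) t\<bar>)" by (rule sum_abs)
      also have "\<dots> \<le> (\<Sum>i\<le>N k. w k i * B\<theta>)"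
        using w0 \<Theta>B that by (intro sum_mono) (auto simp: abs_mult intro!: mult_left_mono)
      also have "\<dots> = B\<theta>" by (simp add: w1 flip: sum_distrib_right)
      finally show ?thesis .
    qed
  qed (use mc[OF \<theta>(1)] h hlim hS S in auto)

  \<comment> \<open>the arguments of the integrand along the convex combinations\<close>
  define A where "A k t = (\<Sum>i\<le>N k. w k i * \<alpha> (\<Theta> (r i)) t)" for k t
  define Q where "Q k t = (\<Sum>i\<le>N k. w k i * (g (r i) t + \<tau> t))" for k t
  have \<alpha>m [measurable]: "\<alpha> (\<Theta> n) \<in> borel_measurable ?M" for n by (intro mc \<alpha>c \<Theta>c)
  have AQm [measurable]: "A k \<in> borel_measurable ?M" "Q k \<in> borel_measurable ?M" for k
    unfolding A_def Q_def by measurable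
  have A0: "0 \<le> A k t" for k t unfolding A_def using w0 \<alpha>0 by (intro sum_nonneg) auto
  have Alim: "(\<lambda>k. A k t) \<longlonglongrightarrow> \<alpha> \<theta> t" if "t \<in> {0<..<l}" for t
    unfolding A_def
  proof (rule convex_weights_tendsto[OF _ w])
    show "(\<lambda>i. \<alpha> (\<Theta> (r i)) t) \<longlonglongrightarrow> \<alpha> \<theta> t"
      unfolding \<alpha>_def by (intro tendsto_intros conv) (use that in auto)
  qed
  have Qlim: "AE t in ?M. (\<lambda>k. Q k t) \<longlonglongrightarrow> h t + \<tau> t"
    using hlim
  proof eventually_elim
    case (elim t)
    have "Q k t = (\<Sum>i\<le>N k. w k i * g (r i) t) + \<tau> t" for k
      using w1[of k] by (simp add: Q_def distrib_left sum.distrib flip: sum_distrib_right)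
    with tendsto_add[OF elim tendsto_const[of "\<tau> t"]] show ?case by simp
  qed
  have Ek: "(\<integral>\<^sup>+t. quot ((A k t + (Q k t)\<^sup>2)\<^sup>2) (A k t) \<partial>?M) \<le> ennreal (\<Sum>i\<le>N k. w k i * E (r i))" for k
  proof -
    let ?F = "\<lambda>i t. quot ((\<alpha> (\<Theta> (r i)) t + (g (r i) t + \<tau> t)\<^sup>2)\<^sup>2) (\<alpha> (\<Theta> (r i)) t)"
    have "(\<integral>\<^sup>+t. quot ((A k t + (Q k t)\<^sup>2)\<^sup>2) (A k t) \<partial>?M) \<le> (\<integral>\<^sup>+t. (\<Sum>i\<le>N k. ennreal (w k i) * ?F i t) \<partial>?M)"
      unfolding A_def Q_def by (intro nn_integral_mono quot_convex[OF w] \<alpha>0)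
    also have "\<dots> = (\<Sum>i\<le>N k. \<integral>\<^sup>+t. ennreal (w k i) * ?F i t \<partial>?M)"
      by (rule nn_integral_sum) measurable
    also have "\<dots> = (\<Sum>i\<le>N k. ennreal (w k i) * (\<integral>\<^sup>+t. ?F i t \<partial>?M))"
      by (intro sum.cong refl nn_integral_cmult) measurable
    also have "\<dots> = (\<Sum>i\<le>N k. ennreal (w k i) * ennreal (E (r i)))"
      using energy[OF \<Theta>c g(2)] E(1) by simp
    also have "\<dots> = ennreal (\<Sum>i\<le>N k. w k i * E (r i))"
      using w0 E(2) by (simp add: ennreal_mult[symmetric])
    finally show ?thesis .
  qed
  have le: "energy l \<gamma> \<theta> \<le> ennreal m"
  proof -
    have "energy l \<gamma> \<theta> = (\<integral>\<^sup>+t. quot ((\<alpha> \<theta> t + (h t + \<tau> t)\<^sup>2)\<^sup>2) (\<alpha> \<theta> t) \<partial>?M)"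
      by (rule energy[OF \<theta>(1) wd])
    also have "\<dots> \<le> (\<integral>\<^sup>+t. liminf (\<lambda>k. quot ((A k t + (Q k t)\<^sup>2)\<^sup>2) (A k t)) \<partial>?M)"
    proof (rule nn_integral_mono_AE)
      show "AE t in ?M. quot ((\<alpha> \<theta> t + (h t + \<tau> t)\<^sup>2)\<^sup>2) (\<alpha> \<theta> t) \<le> liminf (\<lambda>k. quot ((A k t + (Q k t)\<^sup>2)\<^sup>2) (A k t))"
        using Qlim AE_space
      proof eventually_elim
        case (elim t)
        then show ?case by (intro quot_lsc Alim A0) auto
      qed
    qed
    also have "\<dots> \<le> liminf (\<lambda>k. \<integral>\<^sup>+t. quot ((A k t + (Q k t)\<^sup>2)\<^sup>2) (A k t) \<partial>?M)"
      by (rule nn_integral_liminf) measurable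
    also have "\<dots> \<le> liminf (\<lambda>k. ennreal (\<Sum>i\<le>N k. w k i * E (r i)))"
      by (intro Liminf_mono always_eventually allI Ek)
    also have "\<dots> = ennreal m"
    proof (rule lim_imp_Liminf)
      show "(\<lambda>k. ennreal (\<Sum>i\<le>N k. w k i * E (r i))) \<longlonglongrightarrow> ennreal m"
        using LIMSEQ_subseq_LIMSEQ[OF E(3) \<theta>(2)] by (intro tendsto_ennrealI convex_weights_tendsto w) (simp add: comp_def)
    qed simp
    finally show ?thesis .
  qed
  \<comment> \<open>Coercivity, applied to the limit itself: its energy is finite.\<close>
  have "h \<in> L4 l"
  proof -
    have m0: "0 \<le> m" using E by (intro LIMSEQ_le_const[OF E(3)]) auto
    have "(\<integral>\<^sup>+t. ennreal ((h t + \<tau> t) ^ 4 / K) \<partial>?M) \<le> energy l \<gamma> \<theta>"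
      unfolding energy[OF \<theta>(1) wd] by (intro nn_integral_mono quot_ge_fourth_power \<alpha>0 \<alpha>K K(1)) auto
    also note le
    finally have "integrable ?M (\<lambda>t. K * ((h t + \<tau> t) ^ 4 / K))"
      using integrable_nn_integral_le(1)[of "\<lambda>t. (h t + \<tau> t) ^ 4 / K" ?M m] K(1) m0
      by (intro integrable_mult_right) simp
    then have "integrable ?M (\<lambda>t. (h t + \<tau> t) ^ 4)" using K(1) by simp
    then have q: "integrable ?M (\<lambda>t. 8 * (h t + \<tau> t) ^ 4 + 8 * B ^ 4)" by simp
    have "integrable ?M (\<lambda>t. \<bar>h t\<bar> ^ 4)"
    proof (rule Bochner_Integration.integrable_bound[OF q])
      show "AE t in ?M. norm (\<bar>h t\<bar> ^ 4) \<le> norm (8 * (h t + \<tau> t) ^ 4 + 8 * B ^ 4)"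
      proof (rule AE_I2)
        fix t assume "t \<in> space ?M"
        then have "\<bar>\<tau> t\<bar> ^ 4 \<le> B ^ 4" using B(2)[of t] by (intro power_mono) auto
        then have \<tau>4: "(\<tau> t) ^ 4 \<le> B ^ 4" by simp
        have sq: "(x - y)\<^sup>2 \<le> 2 * x\<^sup>2 + 2 * y\<^sup>2" for x y :: real
          using zero_le_power2[of "x + y"] by (simp add: power2_eq_square algebra_simps)
        have "(h t)\<^sup>2 \<le> 2 * (h t + \<tau> t)\<^sup>2 + 2 * (\<tau> t)\<^sup>2" using sq[of "h t + \<tau> t" "\<tau> t"] by simp
        then have "((h t)\<^sup>2)\<^sup>2 \<le> (2 * (h t + \<tau> t)\<^sup>2 + 2 * (\<tau> t)\<^sup>2)\<^sup>2" by (intro power_mono) auto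
        also have "\<dots> \<le> 2 * (2 * (h t + \<tau> t)\<^sup>2)\<^sup>2 + 2 * (2 * (\<tau> t)\<^sup>2)\<^sup>2"
          using sq[of "2 * (h t + \<tau> t)\<^sup>2" "- (2 * (\<tau> t)\<^sup>2)"] by simp
        also have "\<dots> = 8 * (h t + \<tau> t) ^ 4 + 8 * (\<tau> t) ^ 4" by (simp add: power_mult_distrib flip: power_mult)
        finally have "(h t) ^ 4 \<le> 8 * (h t + \<tau> t) ^ 4 + 8 * B ^ 4" using \<tau>4 by (simp flip: power_mult)
        then show "norm (\<bar>h t\<bar> ^ 4) \<le> norm (8 * (h t + \<tau> t) ^ 4 + 8 * B ^ 4)"
          by (simp add: abs_of_nonneg)
      qed
    qed measurable
    then show ?thesis by (simp add: L4_def)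
  qed
  then have "\<theta> \<in> W14 l" by (rule W14_I[OF \<theta>(1) wd])
  then show ?thesis using that \<theta>(2) conv le by blast
qed

text \<open>
  The class \<open>S\<close> stands for either of the two admissible sets. The hypothesis on initial values
  allows a member to be replaced by one of equal energy, which is needed where adding multiples of \<open>\<pi>\<close>
  makes the energy noncoercive.
\<close>
lemma energy_minimizer_exists:
  assumes l: "0 < l" and cont: "continuous_on {0..l} (curvature l \<gamma>)" "continuous_on {0..l} (torsion l \<gamma>)"
    and S: "S \<subseteq> W14 l" "S \<noteq> {}"
    and norm: "\<And>\<theta>. \<theta> \<in> S \<Longrightarrow> \<exists>\<theta>'\<in>S. energy l \<gamma> \<theta>' = energy l \<gamma> \<theta> \<and> \<bar>\<theta>' 0\<bar> \<le> R"
    and closed: "\<And>\<Theta> \<theta>. \<lbrakk>\<And>n::nat. \<Theta> n \<in> S; \<theta> \<in> W14 l; \<And>t. t \<in> {0..l} \<Longrightarrow> (\<lambda>n. \<Theta> n t) \<longlonglongrightarrow> \<theta> t\<rbrakk> \<Longrightarrow> \<theta> \<in> S"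
  shows "\<exists>\<theta>min\<in>S. \<forall>\<theta>\<in>S. energy l \<gamma> \<theta>min \<le> energy l \<gamma> \<theta>"
proof (cases "(INF \<theta>\<in>S. energy l \<gamma> \<theta>) = top")
  case True
  then have "energy l \<gamma> \<theta> = top" if "\<theta> \<in> S" for \<theta> using that INF_lower[of \<theta> S "energy l \<gamma>"] by (simp add: top_unique)
  then show ?thesis using S(2) by auto
next
  case False
  define m where "m = enn2real (INF \<theta>\<in>S. energy l \<gamma> \<theta>)"
  have m: "(INF \<theta>\<in>S. energy l \<gamma> \<theta>) = ennreal m" "0 \<le> m"
    unfolding m_def using False by (simp_all only: ennreal_enn2real_if if_False enn2real_nonneg)
  have lower: "ennreal m \<le> energy l \<gamma> \<theta>" if "\<theta> \<in> S" for \<theta> using that m(1) INF_lower[of \<theta> S "energy l \<gamma>"] by simp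
  have "\<exists>\<theta>\<in>S. energy l \<gamma> \<theta> < ennreal (m + inverse (real (Suc n))) \<and> \<bar>\<theta> 0\<bar> \<le> R" for n
  proof -
    have "(INF \<theta>\<in>S. energy l \<gamma> \<theta>) < ennreal (m + inverse (real (Suc n)))"
      unfolding m(1) using m(2) by (subst ennreal_less_iff) auto
    then obtain \<theta> where \<theta>: "\<theta> \<in> S" "energy l \<gamma> \<theta> < ennreal (m + inverse (real (Suc n)))"
      unfolding INF_less_iff by blast
    obtain \<theta>' where "\<theta>' \<in> S" "energy l \<gamma> \<theta>' = energy l \<gamma> \<theta>" "\<bar>\<theta>' 0\<bar> \<le> R" using norm[OF \<theta>(1)] by blast
    with \<theta>(2) show ?thesis by (intro bexI[of _ \<theta>']) simp_all
  qed
  then obtain \<Theta> where \<Theta>: "\<And>n. \<Theta> n \<in> S" "\<And>n. energy l \<gamma> (\<Theta> n) < ennreal (m + inverse (real (Suc n)))" "\<And>n. \<bar>\<Theta> n 0\<bar> \<le> R"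
    by metis
  define E where "E n = enn2real (energy l \<gamma> (\<Theta> n))" for n
  have E: "energy l \<gamma> (\<Theta> n) = ennreal (E n)" "0 \<le> E n" for n
  proof -
    have "energy l \<gamma> (\<Theta> n) < top" using \<Theta>(2)[of n] ennreal_less_top by (rule order.strict_trans)
    then show "energy l \<gamma> (\<Theta> n) = ennreal (E n)" "0 \<le> E n" by (simp_all add: E_def)
  qed
  have Em: "m \<le> E n" "E n \<le> m + inverse (real (Suc n))" for n
  proof -
    show "m \<le> E n" using lower[OF \<Theta>(1)[of n]] E(2)[of n] unfolding E(1) by simp
    show "E n \<le> m + inverse (real (Suc n))"
      using \<Theta>(2)[of n] unfolding E(1) ennreal_less_iff[OF E(2)] by (rule less_imp_le)
  qed
  have lim: "(\<lambda>n. m + inverse (real (Suc n))) \<longlonglongrightarrow> m"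
    using tendsto_add[OF tendsto_const[of m] LIMSEQ_inverse_real_of_nat] by simp
  have "E \<longlonglongrightarrow> m"
    by (rule tendsto_sandwich[OF _ _ tendsto_const lim]) (use Em in auto)
  then obtain \<theta> r where \<theta>: "\<theta> \<in> W14 l" "strict_mono r" "\<And>t. t \<in> {0..l} \<Longrightarrow> (\<lambda>n. \<Theta> (r n) t) \<longlonglongrightarrow> \<theta> t"
    "energy l \<gamma> \<theta> \<le> ennreal m"
    using energy_sequentially_compact[OF l cont, of \<Theta> E m R] S(1) \<Theta> E by blast
  have "\<theta> \<in> S" by (rule closed[of "\<lambda>n. \<Theta> (r n)"]) (use \<Theta>(1) \<theta> in auto)
  then show ?thesis using \<theta>(4) lower by (meson order_trans)
qed

theorem theorem1p1:
  fixes l :: real and \<gamma> :: "real \<Rightarrow> real^3"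
  assumes "l > 0"
    and "Ck_on 3 {0..l} \<gamma>"
    and "\<forall>t\<in>{0..l}. norm (tangent l \<gamma> t) = 1"
    and "\<forall>t\<in>{0..l}. curvature l \<gamma> t > 0"
  shows "(\<exists>\<theta>min\<in>W14 l. \<forall>\<theta>\<in>W14 l. energy l \<gamma> \<theta>min \<le> energy l \<gamma> \<theta>) \<and>
    (\<forall>a b. \<exists>\<theta>min\<in>{\<theta>\<in>W14 l. \<theta> 0 = a \<and> \<theta> l = b}.
       \<forall>\<theta>\<in>{\<theta>\<in>W14 l. \<theta> 0 = a \<and> \<theta> l = b}. energy l \<gamma> \<theta>min \<le> energy l \<gamma> \<theta>)"
proof (intro conjI allI)
  note cont = continuous_curvature_torsion[OF assms(1,2,4)]
  have affine_W14: "(\<lambda>t. p + q * t) \<in> W14 l" for p q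
    by (rule W14_I[OF _ has_weak_deriv_affine[OF assms(1)]])
       (auto intro!: continuous_intros continuous_imp_L4)
  show "\<exists>\<theta>min\<in>W14 l. \<forall>\<theta>\<in>W14 l. energy l \<gamma> \<theta>min \<le> energy l \<gamma> \<theta>"
  proof (rule energy_minimizer_exists[OF assms(1) cont, of _ pi])
    fix \<theta> assume \<theta>: "\<theta> \<in> W14 l"
    \<comment> \<open>This shift moves the initial value into \<open>[0, \<pi>]\<close>.\<close>
    define k where "k = - \<lfloor>\<theta> 0 / pi\<rfloor>"
    have "of_int \<lfloor>\<theta> 0 / pi\<rfloor> * pi \<le> \<theta> 0" "\<theta> 0 \<le> (of_int \<lfloor>\<theta> 0 / pi\<rfloor> + 1) * pi"
      by (rule pos_le_divide_eq[THEN iffD1, OF pi_gt_zero of_int_floor_le]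
          pos_divide_le_eq[THEN iffD1, OF pi_gt_zero real_of_int_floor_add_one_ge])+
    then have "\<bar>\<theta> 0 + of_int k * pi\<bar> \<le> pi" by (simp add: k_def abs_le_iff algebra_simps)
    with energy_add_multiple_pi[OF assms(1) \<theta>, where k = k]
    show "\<exists>\<theta>'\<in>W14 l. energy l \<gamma> \<theta>' = energy l \<gamma> \<theta> \<and> \<bar>\<theta>' 0\<bar> \<le> pi" by blast
  qed (use affine_W14 in auto)
  fix a b
  show "\<exists>\<theta>min\<in>{\<theta>\<in>W14 l. \<theta> 0 = a \<and> \<theta> l = b}.
       \<forall>\<theta>\<in>{\<theta>\<in>W14 l. \<theta> 0 = a \<and> \<theta> l = b}. energy l \<gamma> \<theta>min \<le> energy l \<gamma> \<theta>"
  proof (rule energy_minimizer_exists[OF assms(1) cont, of _ "\<bar>a\<bar>"])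
    have "(\<lambda>t. a + (b - a) / l * t) \<in> {\<theta>\<in>W14 l. \<theta> 0 = a \<and> \<theta> l = b}"
      using affine_W14[of a "(b - a) / l"] assms(1) by simp
    then show "{\<theta>\<in>W14 l. \<theta> 0 = a \<and> \<theta> l = b} \<noteq> {}" by blast
  next
    fix \<Theta> \<theta> assume \<Theta>: "\<And>n::nat. \<Theta> n \<in> {\<theta>\<in>W14 l. \<theta> 0 = a \<and> \<theta> l = b}" and "\<theta> \<in> W14 l"
      and lim: "\<And>t. t \<in> {0..l} \<Longrightarrow> (\<lambda>n. \<Theta> n t) \<longlonglongrightarrow> \<theta> t"
    have "(\<lambda>n. \<Theta> n 0) \<longlonglongrightarrow> a" "(\<lambda>n. \<Theta> n l) \<longlonglongrightarrow> b" using \<Theta> by simp_all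
    then show "\<theta> \<in> {\<theta>\<in>W14 l. \<theta> 0 = a \<and> \<theta> l = b}"
      using lim[of 0] lim[of l] assms(1) \<open>\<theta> \<in> W14 l\<close> LIMSEQ_unique by force
  qed auto
qed

end
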